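(* Let $L$ and $L^*$ be two Finsler structures on a manifold $M$, with Cartan connections $\nabla,\nabla^*$ and associated $\pi$-tensor fields $A(\overline X,\overline Y)=\nabla^*_{\gamma\overline X}\overline Y-\nabla_{\gamma\overline X}\overline Y$ and $B(\overline X,\overline Y)=\nabla^*_{\beta\overline X}\overline Y-\nabla_{\beta\overline X}\overline Y$. Assume that $B=0$. Let $(M,L)$ (resp. $(M,L^* )$) be a Berwald manifold. Then $(M,L^* )$ (resp. $(M,L)$) is a Berwald manifold if and only if $\nabla_{\beta\overline X}A=0$ for all $\overline X\in\mathfrak X(\pi(M))$.
   Context: $M$ is a finite-dimensional $C^\infty$ manifold and all objects are $C^\infty$. $\pi:\mathcal TM\to M$ is the bundle of nonzero tangent vectors; $\pi^{-1}(TM)\to\mathcal TM$ is the pullback of $TM$ by $\pi$. Sections of $\pi^{-1}(TM)$ are called $\pi$-vector fields, form the module $\mathfrak X(\pi(M))$, and are written $\overline X$; tensor fields on $\pi^{-1}(TM)$ are called $\pi$-tensor fields. $\overline\eta(u)=(u,u)$ is the fundamental $\pi$-vector field. There is an exact sequence $0\to\pi^{-1}(TM)\xrightarrow{\gamma}T(\mathcal TM)\xrightarrow{\rho}\pi^{-1}(TM)\to0$, where $\gamma(u,v)$ is the vertical lift of $v$ to $u$ and $\rho(X)=(u,d\pi(X))$ for $X\in T_u(\mathcal TM)$. For a connection $\nabla$ on $\pi^{-1}(TM)$, its connection map is $K(X)=\nabla_X\overline\eta$, $X\in T(\mathcal TM)$. The horizontal space is $H_u=\{X\in T_u(\mathcal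 TM):K(X)=0\}$, the vertical space is $V_u=\ker\rho_u$; $\nabla$ is regular if $T_u(\mathcal TM)=V_u\oplus H_u$ for all $u$, and then $\beta=(\rho|_{H})^{-1}:\pi^{-1}(TM)\to H$. The torsion form is $\mathbf T(X,Y)=\nabla_X\rho Y-\nabla_Y\rho X-\rho[X,Y]$, with $S(\overline X,\overline Y)=\mathbf T(\beta\overline X,\beta\overline Y)$ and $T(\overline X,\overline Y)=\mathbf T(\gamma\overline X,\beta\overline Y)$. A Finsler structure $L:TM\to[0,\infty)$ is smooth on $\mathcal TM$, positively homogeneous of degree 1 on fibres, with $g$ := fibrewise Hessian of $\frac12L^2$ positive definite (a metric on $\pi^{-1}(TM)$). Its Cartan connection is the unique regular connection $\nabla$ on $\pi^{-1}(TM)$ with $\nabla g=0$, $S=0$ and $g(T(\overline X,\overline Y),\overline Z)=g(T(\overline X,\overline Z),\overline Y)$; it satisfies $K\circ\gamma=\mathrm{id}$, so $X=\gamma KX+\beta\rho X$. Objects of $(M,L^* )$ carry an asterisk ($\nabla^*,\beta^*,T^*,\dots$). Covariant derivatives of $\pi$-tensor fields are the usual ones, e.g. $(\nabla_XA)(\overline Y,\overline Z)=\nabla_X(A(\overline Y,\overline Z))-A(\nabla_X\overline Y,\overline Z)-A(\overline Y,\nabla_X\overline Z)$. $(M,L)$ is a Berwald manifold if $\nabla_{\beta\overline X}T=0$ for every $\overline X\in\mathfrak X(\pi(M))$; $(M,L^* )$ is Berwald if $\nabla^*_{\beta^*\overline X}T^*=0$ for every $\overline X$. *)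

theory Defs
  imports "HOL-Analysis.Analysis" "HOL-Library.Function_Algebras"
begin

section \<open>Pointwise real vector space structure on functions\<close>

instantiation "fun" :: (type, real_vector) real_vector
begin

definition scaleR_fun :: "real \<Rightarrow> ('a \<Rightarrow> 'b) \<Rightarrow> 'a \<Rightarrow> 'b"
  where "scaleR_fun r f = (\<lambda>x. r *\<^sub>R f x)"

instance
  by standard (auto simp: scaleR_fun_def fun_eq_iff algebra_simps)

end

section \<open>Smooth manifolds\<close>

text \<open>\<^term>\<open>ck_on k S f\<close> is meant for open \<^term>\<open>S\<close>.\<close>

primrec ck_on :: "nat \<Rightarrow> 'a::real_normed_vector set \<Rightarrow> ('a \<Rightarrow> 'b::real_normed_vector) \<Rightarrow> bool" where
  "ck_on 0 S f \<longleftrightarrow> continuous_on S f"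
| "ck_on (Suc k) S f \<longleftrightarrow> (\<forall>x\<in>S. f differentiable (at x)) \<and>
     (\<forall>v. ck_on k S (\<lambda>x. frechet_derivative f (at x) v))"

definition smooth_on :: "'a::real_normed_vector set \<Rightarrow> ('a \<Rightarrow> 'b::real_normed_vector) \<Rightarrow> bool"
  where "smooth_on S f \<longleftrightarrow> (\<forall>k. ck_on k S f)"

text \<open>
  A manifold modelled on \<open>'e\<close> is given by a set of points and an atlas indexed by the type \<open>'i\<close>.
  The atlas need not be maximal, and it determines the topology.
\<close>

record ('m, 'i, 'e) mfd =
  pts :: "'m set"
  cdom :: "'i \<Rightarrow> 'm set"
  chart :: "'i \<Rightarrow> 'm \<Rightarrow> 'e"

definition cinv :: "('m, 'i, 'e) mfd \<Rightarrow> 'i \<Rightarrow> 'e \<Rightarrow> 'm"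
  where "cinv M i = inv_into (cdom M i) (chart M i)"

definition mopen :: "('m, 'i, 'e::euclidean_space) mfd \<Rightarrow> 'm set \<Rightarrow> bool"
  where "mopen M W \<longleftrightarrow> W \<subseteq> pts M \<and> (\<forall>i. open (chart M i ` (W \<inter> cdom M i)))"

definition mtop :: "('m, 'i, 'e::euclidean_space) mfd \<Rightarrow> 'm topology"
  where "mtop M = topology (mopen M)"

lemma openin_mtop:
  assumes "\<And>i. inj_on (chart M i) (cdom M i)"
  shows "openin (mtop M) = mopen M"
proof -
  have "chart M i ` (S \<inter> T \<inter> cdom M i) = chart M i ` (S \<inter> cdom M i) \<inter> chart M i ` (T \<inter> cdom M i)"
    for S T i
    using inj_on_image_Int[OF assms, of "S \<inter> cdom M i" i "T \<inter> cdom M i"]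
    by (simp add: Int_ac)
  moreover have "chart M i ` (\<Union>\<K> \<inter> cdom M i) = (\<Union>S\<in>\<K>. chart M i ` (S \<inter> cdom M i))" for \<K> i
    by blast
  ultimately have "istopology (mopen M)"
    unfolding istopology_def mopen_def by (auto intro!: open_UN)
  then show ?thesis
    by (simp add: mtop_def)
qed

definition manifold :: "('m, 'i, 'e::euclidean_space) mfd \<Rightarrow> bool" where
  "manifold M \<longleftrightarrow>
     pts M = (\<Union>i. cdom M i) \<and>
     (\<forall>i. inj_on (chart M i) (cdom M i)) \<and>
     (\<forall>i j. open (chart M i ` (cdom M i \<inter> cdom M j)) \<and>
            smooth_on (chart M i ` (cdom M i \<inter> cdom M j)) (chart M j \<circ> cinv M i)) \<and>
     Hausdorff_space (mtop M) \<and> second_countable (mtop M)"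

definition open_sub :: "('m, 'i, 'e) mfd \<Rightarrow> 'm set \<Rightarrow> ('m, 'i, 'e) mfd" where
  "open_sub M W = \<lparr>pts = pts M \<inter> W, cdom = (\<lambda>i. cdom M i \<inter> W), chart = chart M\<rparr>"

definition smooth_map :: "('m, 'i, 'e::euclidean_space) mfd \<Rightarrow> ('n, 'j, 'f::euclidean_space) mfd
    \<Rightarrow> ('m \<Rightarrow> 'n) \<Rightarrow> bool" where
  "smooth_map M N f \<longleftrightarrow> f ` pts M \<subseteq> pts N \<and>
     (\<forall>i j. open (chart M i ` (cdom M i \<inter> f -` cdom N j)) \<and>
            smooth_on (chart M i ` (cdom M i \<inter> f -` cdom N j)) (chart N j \<circ> f \<circ> cinv M i))"

definition smooth_fun :: "('m, 'i, 'e::euclidean_space) mfd \<Rightarrow> ('m \<Rightarrow> real) \<Rightarrow> bool" where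
  "smooth_fun M f \<longleftrightarrow> (\<forall>i. smooth_on (chart M i ` cdom M i) (f \<circ> cinv M i))"

text \<open>
  A tangent vector at \<open>p\<close> is the family of its components in the charts around \<open>p\<close>, which
  transform by the Jacobians of the changes of coordinates. Components in charts that do not
  contain \<open>p\<close> are \<open>0\<close>, so that the vector space operations are the pointwise ones.
\<close>

definition tspace :: "('m, 'i, 'e::euclidean_space) mfd \<Rightarrow> 'm \<Rightarrow> ('i \<Rightarrow> 'e) set" where
  "tspace M p = {v. (\<forall>i. p \<notin> cdom M i \<longrightarrow> v i = 0) \<and>
     (\<forall>i j. p \<in> cdom M i \<inter> cdom M j \<longrightarrow>
        v j = frechet_derivative (chart M j \<circ> cinv M i) (at (chart M i p)) (v i))}"

definition tbundle :: "('m, 'i, 'e::euclidean_space) mfd \<Rightarrow> ('m \<times> ('i \<Rightarrow> 'e), 'i, 'e \<times> 'e) mfd" where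
  "tbundle M =
     \<lparr>pts = Sigma (pts M) (tspace M),
      cdom = (\<lambda>i. Sigma (cdom M i) (tspace M)),
      chart = (\<lambda>i (p, v). (chart M i p, v i))\<rparr>"

text \<open>The derivative of \<open>f\<close> along a tangent vector at \<open>p\<close>; it does not depend on the chart.\<close>

definition dirderiv :: "('m, 'i, 'e::euclidean_space) mfd \<Rightarrow> ('m \<Rightarrow> 'b::real_normed_vector)
    \<Rightarrow> 'm \<Rightarrow> ('i \<Rightarrow> 'e) \<Rightarrow> 'b" where
  "dirderiv M f p v = (let i = (SOME i. p \<in> cdom M i) in
     frechet_derivative (f \<circ> cinv M i) (at (chart M i p)) (v i))"

definition differential :: "('m, 'i, 'e::euclidean_space) mfd \<Rightarrow> ('n, 'j, 'f::euclidean_space) mfd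
    \<Rightarrow> ('m \<Rightarrow> 'n) \<Rightarrow> 'm \<Rightarrow> ('i \<Rightarrow> 'e) \<Rightarrow> ('j \<Rightarrow> 'f)" where
  "differential M N f p v =
     (\<lambda>j. if f p \<in> cdom N j then dirderiv M (chart N j \<circ> f) p v else 0)"

definition vector_fields :: "('m, 'i, 'e::euclidean_space) mfd \<Rightarrow> 'm set \<Rightarrow> ('m \<Rightarrow> 'i \<Rightarrow> 'e) set" where
  "vector_fields M W = {X. smooth_map (open_sub M W) (tbundle M) (\<lambda>p. (p, X p))}"

definition lie_bracket :: "('m, 'i, 'e::euclidean_space) mfd \<Rightarrow> ('m \<Rightarrow> 'i \<Rightarrow> 'e)
    \<Rightarrow> ('m \<Rightarrow> 'i \<Rightarrow> 'e) \<Rightarrow> ('m \<Rightarrow> 'i \<Rightarrow> 'e)" where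
  "lie_bracket M X Y p = (\<lambda>i. if p \<in> cdom M i
     then dirderiv M (\<lambda>q. Y q i) p (X p) - dirderiv M (\<lambda>q. X q i) p (Y p) else 0)"

section \<open>The pullback bundle over the nonzero tangent vectors\<close>

definition slit :: "('m, 'i, 'e::euclidean_space) mfd \<Rightarrow> ('m \<times> ('i \<Rightarrow> 'e), 'i, 'e \<times> 'e) mfd" where
  "slit M = open_sub (tbundle M) {u. snd u \<noteq> 0}"

text \<open>
  The fibre of the pullback bundle over \<open>u\<close> is \<open>tspace M (fst u)\<close>, and a section \<open>Y\<close> over \<open>W\<close>
  is identified with the map \<open>u \<mapsto> (fst u, Y u)\<close> into the tangent bundle.
\<close>

type_synonym ('m, 'i, 'e) pifield = "'m \<times> ('i \<Rightarrow> 'e) \<Rightarrow> 'i \<Rightarrow> 'e"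
type_synonym ('m, 'i, 'e) slitfield = "'m \<times> ('i \<Rightarrow> 'e) \<Rightarrow> 'i \<Rightarrow> 'e \<times> 'e"
type_synonym ('m, 'i, 'e) pitensor =
  "('m, 'i, 'e) pifield \<Rightarrow> ('m, 'i, 'e) pifield \<Rightarrow> ('m, 'i, 'e) pifield"

definition pifields_on :: "('m, 'i, 'e::euclidean_space) mfd \<Rightarrow> ('m \<times> ('i \<Rightarrow> 'e)) set
    \<Rightarrow> ('m, 'i, 'e) pifield set" where
  "pifields_on M W = {Y. smooth_map (open_sub (slit M) W) (tbundle M) (\<lambda>u. (fst u, Y u))}"

definition pifields :: "('m, 'i, 'e::euclidean_space) mfd \<Rightarrow> ('m, 'i, 'e) pifield set"
  where "pifields M = pifields_on M (pts (slit M))"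

definition fundamental :: "('m, 'i, 'e) pifield"
  where "fundamental u = snd u"

text \<open>The vertical lift of \<open>v\<close> is the velocity at \<open>t = 0\<close> of the curve \<open>u + t v\<close>.\<close>

definition vlift :: "('m, 'i, 'e::euclidean_space) mfd \<Rightarrow> 'm \<times> ('i \<Rightarrow> 'e)
    \<Rightarrow> ('i \<Rightarrow> 'e) \<Rightarrow> ('i \<Rightarrow> 'e \<times> 'e)" where
  "vlift M u v = (\<lambda>i. if u \<in> cdom (slit M) i
     then vector_derivative (\<lambda>t. chart (slit M) i (fst u, snd u + t *\<^sub>R v)) (at 0) else 0)"

definition rho :: "('m, 'i, 'e::euclidean_space) mfd \<Rightarrow> 'm \<times> ('i \<Rightarrow> 'e)
    \<Rightarrow> ('i \<Rightarrow> 'e \<times> 'e) \<Rightarrow> ('i \<Rightarrow> 'e)"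
  where "rho M = differential (slit M) M fst"

section \<open>Connections on the pullback bundle\<close>

text \<open>
  \<open>D u \<xi> Y\<close> is the covariant derivative at \<open>u\<close> of \<open>Y\<close> along the vector \<open>\<xi>\<close> tangent to the slit
  bundle at \<open>u\<close>. It is constrained for all \<open>Y\<close> that are smooth near \<open>u\<close>, that is, the operation
  on global sections is given together with its canonical extension to local sections. Locality
  in \<open>Y\<close> is a consequence of the Leibniz rule, as \<open>f\<close> may be the indicator function of an
  open set.
\<close>

type_synonym ('m, 'i, 'e) connection =
  "'m \<times> ('i \<Rightarrow> 'e) \<Rightarrow> ('i \<Rightarrow> 'e \<times> 'e) \<Rightarrow> ('m, 'i, 'e) pifield \<Rightarrow> ('i \<Rightarrow> 'e)"

definition is_connection :: "('m, 'i, 'e::euclidean_space) mfd \<Rightarrow> ('m, 'i, 'e) connection \<Rightarrow> bool" where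
  "is_connection M D \<longleftrightarrow> (\<forall>W. mopen (slit M) W \<longrightarrow>
     (\<forall>u\<in>W. \<forall>Y\<in>pifields_on M W.
        (\<forall>\<xi>\<in>tspace (slit M) u. \<forall>\<zeta>\<in>tspace (slit M) u. \<forall>a b.
           D u (a *\<^sub>R \<xi> + b *\<^sub>R \<zeta>) Y = a *\<^sub>R D u \<xi> Y + b *\<^sub>R D u \<zeta> Y) \<and>
        (\<forall>\<xi>\<in>tspace (slit M) u. \<forall>Z\<in>pifields_on M W.
           D u \<xi> (\<lambda>w. Y w + Z w) = D u \<xi> Y + D u \<xi> Z) \<and>
        (\<forall>\<xi>\<in>tspace (slit M) u. \<forall>f. smooth_fun (open_sub (slit M) W) f \<longrightarrow>
           D u \<xi> (\<lambda>w. f w *\<^sub>R Y w) = dirderiv (slit M) f u \<xi> *\<^sub>R Y u + f u *\<^sub>R D u \<xi> Y)) \<and>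
     (\<forall>X\<in>vector_fields (slit M) W. \<forall>Y\<in>pifields_on M W. (\<lambda>u. D u (X u) Y) \<in> pifields_on M W))"

definition connection_map :: "('m, 'i, 'e) connection \<Rightarrow> 'm \<times> ('i \<Rightarrow> 'e) \<Rightarrow> ('i \<Rightarrow> 'e \<times> 'e) \<Rightarrow> ('i \<Rightarrow> 'e)"
  where "connection_map D u \<xi> = D u \<xi> fundamental"

definition hspace :: "('m, 'i, 'e::euclidean_space) mfd \<Rightarrow> ('m, 'i, 'e) connection
    \<Rightarrow> 'm \<times> ('i \<Rightarrow> 'e) \<Rightarrow> ('i \<Rightarrow> 'e \<times> 'e) set"
  where "hspace M D u = {\<xi> \<in> tspace (slit M) u. connection_map D u \<xi> = 0}"

definition vspace :: "('m, 'i, 'e::euclidean_space) mfd \<Rightarrow> 'm \<times> ('i \<Rightarrow> 'e) \<Rightarrow> ('i \<Rightarrow> 'e \<times> 'e) set"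
  where "vspace M u = {\<xi> \<in> tspace (slit M) u. rho M u \<xi> = 0}"

definition regular :: "('m, 'i, 'e::euclidean_space) mfd \<Rightarrow> ('m, 'i, 'e) connection \<Rightarrow> bool" where
  "regular M D \<longleftrightarrow> (\<forall>u\<in>pts (slit M).
     vspace M u \<inter> hspace M D u = {0} \<and>
     tspace (slit M) u = {\<xi> + \<zeta> | \<xi> \<zeta>. \<xi> \<in> vspace M u \<and> \<zeta> \<in> hspace M D u})"

definition hlift :: "('m, 'i, 'e::euclidean_space) mfd \<Rightarrow> ('m, 'i, 'e) connection
    \<Rightarrow> 'm \<times> ('i \<Rightarrow> 'e) \<Rightarrow> ('i \<Rightarrow> 'e) \<Rightarrow> ('i \<Rightarrow> 'e \<times> 'e)"
  where "hlift M D u = inv_into (hspace M D u) (rho M u)"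

definition cov :: "('m, 'i, 'e) connection \<Rightarrow> ('m, 'i, 'e) slitfield
    \<Rightarrow> ('m, 'i, 'e) pifield \<Rightarrow> ('m, 'i, 'e) pifield"
  where "cov D X Y = (\<lambda>u. D u (X u) Y)"

definition vfield :: "('m, 'i, 'e::euclidean_space) mfd \<Rightarrow> ('m, 'i, 'e) pifield \<Rightarrow> ('m, 'i, 'e) slitfield"
  where "vfield M X = (\<lambda>u. vlift M u (X u))"

definition hfield :: "('m, 'i, 'e::euclidean_space) mfd \<Rightarrow> ('m, 'i, 'e) connection
    \<Rightarrow> ('m, 'i, 'e) pifield \<Rightarrow> ('m, 'i, 'e) slitfield"
  where "hfield M D X = (\<lambda>u. hlift M D u (X u))"

definition rhofield :: "('m, 'i, 'e::euclidean_space) mfd \<Rightarrow> ('m, 'i, 'e) slitfield \<Rightarrow> ('m, 'i, 'e) pifield"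
  where "rhofield M X = (\<lambda>u. rho M u (X u))"

definition torsion :: "('m, 'i, 'e::euclidean_space) mfd \<Rightarrow> ('m, 'i, 'e) connection
    \<Rightarrow> ('m, 'i, 'e) slitfield \<Rightarrow> ('m, 'i, 'e) slitfield \<Rightarrow> ('m, 'i, 'e) pifield" where
  "torsion M D X Y = (\<lambda>u. cov D X (rhofield M Y) u - cov D Y (rhofield M X) u
     - rhofield M (lie_bracket (slit M) X Y) u)"

definition hh_torsion :: "('m, 'i, 'e::euclidean_space) mfd \<Rightarrow> ('m, 'i, 'e) connection
    \<Rightarrow> ('m, 'i, 'e) pitensor"
  where "hh_torsion M D X Y = torsion M D (hfield M D X) (hfield M D Y)"

definition vh_torsion :: "('m, 'i, 'e::euclidean_space) mfd \<Rightarrow> ('m, 'i, 'e) connection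
    \<Rightarrow> ('m, 'i, 'e) pitensor"
  where "vh_torsion M D X Y = torsion M D (vfield M X) (hfield M D Y)"

definition cov_tensor :: "('m, 'i, 'e) connection \<Rightarrow> ('m, 'i, 'e::euclidean_space) slitfield
    \<Rightarrow> ('m, 'i, 'e) pitensor \<Rightarrow> ('m, 'i, 'e) pitensor" where
  "cov_tensor D X A Y Z = (\<lambda>u. cov D X (A Y Z) u - A (cov D X Y) Z u - A Y (cov D X Z) u)"

definition vanishes :: "('m, 'i, 'e::euclidean_space) mfd \<Rightarrow> ('m, 'i, 'e) pitensor \<Rightarrow> bool" where
  "vanishes M A \<longleftrightarrow> (\<forall>Y\<in>pifields M. \<forall>Z\<in>pifields M. \<forall>u\<in>pts (slit M). A Y Z u = 0)"

definition h_parallel :: "('m, 'i, 'e::euclidean_space) mfd \<Rightarrow> ('m, 'i, 'e) connection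
    \<Rightarrow> ('m, 'i, 'e) pitensor \<Rightarrow> bool" where
  "h_parallel M D A \<longleftrightarrow> (\<forall>X\<in>pifields M. vanishes M (cov_tensor D (hfield M D X) A))"

section \<open>Finsler structures and Cartan connections\<close>

text \<open>The Hessian at \<open>snd u\<close> of half the square of \<open>L\<close> restricted to \<open>tspace M (fst u)\<close>.\<close>

definition fmetric :: "('m \<times> ('i \<Rightarrow> 'e) \<Rightarrow> real) \<Rightarrow> 'm \<times> ('i \<Rightarrow> 'e)
    \<Rightarrow> ('i \<Rightarrow> 'e) \<Rightarrow> ('i \<Rightarrow> 'e::euclidean_space) \<Rightarrow> real" where
  "fmetric L u v w =
     deriv (\<lambda>s. deriv (\<lambda>t. (L (fst u, snd u + s *\<^sub>R v + t *\<^sub>R w))\<^sup>2 / 2) 0) 0"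

definition finsler :: "('m, 'i, 'e::euclidean_space) mfd \<Rightarrow> ('m \<times> ('i \<Rightarrow> 'e) \<Rightarrow> real) \<Rightarrow> bool" where
  "finsler M L \<longleftrightarrow>
     (\<forall>u\<in>pts (tbundle M). L u \<ge> 0) \<and>
     smooth_fun (slit M) L \<and>
     (\<forall>(p, y)\<in>pts (tbundle M). \<forall>r>0. L (p, r *\<^sub>R y) = r * L (p, y)) \<and>
     (\<forall>u\<in>pts (slit M). \<forall>v\<in>tspace M (fst u). v \<noteq> 0 \<longrightarrow> fmetric L u v v > 0)"

definition metric_connection :: "('m, 'i, 'e::euclidean_space) mfd \<Rightarrow> ('m \<times> ('i \<Rightarrow> 'e) \<Rightarrow> real)
    \<Rightarrow> ('m, 'i, 'e) connection \<Rightarrow> bool" where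
  "metric_connection M L D \<longleftrightarrow> (\<forall>Y\<in>pifields M. \<forall>Z\<in>pifields M.
     \<forall>u\<in>pts (slit M). \<forall>\<xi>\<in>tspace (slit M) u.
       dirderiv (slit M) (\<lambda>w. fmetric L w (Y w) (Z w)) u \<xi>
         = fmetric L u (D u \<xi> Y) (Z u) + fmetric L u (Y u) (D u \<xi> Z))"

definition cartan_connection :: "('m, 'i, 'e::euclidean_space) mfd \<Rightarrow> ('m \<times> ('i \<Rightarrow> 'e) \<Rightarrow> real)
    \<Rightarrow> ('m, 'i, 'e) connection \<Rightarrow> bool" where
  "cartan_connection M L D \<longleftrightarrow>
     is_connection M D \<and> regular M D \<and> metric_connection M L D \<and>
     vanishes M (hh_torsion M D) \<and>
     (\<forall>X\<in>pifields M. \<forall>Y\<in>pifields M. \<forall>Z\<in>pifields M. \<forall>u\<in>pts (slit M).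
        fmetric L u (vh_torsion M D X Y u) (Z u) = fmetric L u (vh_torsion M D X Z u) (Y u))"

text \<open>The argument is the Cartan connection of the Finsler structure in question.\<close>

definition berwald :: "('m, 'i, 'e::euclidean_space) mfd \<Rightarrow> ('m, 'i, 'e) connection \<Rightarrow> bool"
  where "berwald M D \<longleftrightarrow> h_parallel M D (vh_torsion M D)"

text \<open>In both difference tensors the lifts are those of the first connection \<open>D\<close>.\<close>

definition vert_difference :: "('m, 'i, 'e::euclidean_space) mfd \<Rightarrow> ('m, 'i, 'e) connection
    \<Rightarrow> ('m, 'i, 'e) connection \<Rightarrow> ('m, 'i, 'e) pitensor" where
  "vert_difference M D D' X Y = (\<lambda>u. cov D' (vfield M X) Y u - cov D (vfield M X) Y u)"

definition hor_difference :: "('m, 'i, 'e::euclidean_space) mfd \<Rightarrow> ('m, 'i, 'e) connection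
    \<Rightarrow> ('m, 'i, 'e) connection \<Rightarrow> ('m, 'i, 'e) pitensor" where
  "hor_difference M D D' X Y = (\<lambda>u. cov D' (hfield M D X) Y u - cov D (hfield M D X) Y u)"

end

theory Submission
  imports Defs
begin

text \<open>
  The mixed torsion \<open>T\<close> of a regular connection \<open>\<nabla>\<close> has a simple description. In induced coordinates
  \<open>(x, y)\<close> of the slit tangent bundle the vertical lift of \<open>X\<close> is \<open>(0, X)\<close> and the horizontal lift of \<open>Y\<close>
  is \<open>(Y, \<dots>)\<close>, so \<open>\<rho>[\<gamma>X, \<beta>Y]\<close> is the derivative of \<open>Y\<close> along \<open>X\<close> in the fibre, an expression in which no
  connection occurs. Since \<open>\<rho>(\<beta>Y) = Y\<close> and \<open>\<rho>(\<gamma>X) = 0\<close>, it follows that \<open>T(X, Y) = \<nabla>\<^bsub>\<gamma>X\<^esub>Y\<close> minus that fibre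
  derivative (lemma \<open>vh_torsion_eq\<close>). Subtracting two such formulas gives
  \<open>T' = T + A\<close> (lemma \<open>vh_torsion_difference\<close>), whatever the two horizontal lifts are.

  Suppose now that \<open>B = 0\<close>, that is, \<open>\<nabla>'\<close> and \<open>\<nabla>\<close> agree in the directions \<open>\<beta>X\<close>. Applied to the fundamental
  field this says that the connection map of \<open>\<nabla>'\<close> vanishes on \<open>\<beta>X\<close>, so \<open>\<beta>X\<close> is horizontal for \<open>\<nabla>'\<close>
  as well, and \<open>\<beta>' = \<beta>\<close> (lemma \<open>hfield_eq\<close>). Hence \<open>\<nabla>'\<close> along \<open>\<beta>'X\<close> is \<open>\<nabla>\<close> along \<open>\<beta>X\<close>, on fields and
  therefore on tensors, and \<open>\<nabla>'\<^bsub>\<beta>'X\<^esub>T' = \<nabla>\<^bsub>\<beta>X\<^esub>T + \<nabla>\<^bsub>\<beta>X\<^esub>A\<close> (lemma \<open>cov_vh_torsion_difference\<close>). If one of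
  \<open>\<nabla>'T'\<close> and \<open>\<nabla>T\<close> vanishes in these directions, then the other one does iff \<open>\<nabla>A\<close> does.

  Most of the work goes into showing that all fields in this computation are smooth, as the
  connections are only constrained on smooth fields. By the lemma \<open>smooth_section_iff\<close> this can be
  checked chart by chart. The delicate case is the horizontal lift, which is defined pointwise as an
  inverse: in a chart it is the solution of a linear system with smooth nondegenerate coefficients,
  and such solutions are smooth (lemma \<open>ck_on_linear_system_solution\<close>).
\<close>

section \<open>Calculus of smooth maps\<close>

lemma frechet_derivative_cong_open:
  assumes "open S" "x \<in> S" "\<And>y. y \<in> S \<Longrightarrow> f y = g y"
  shows "frechet_derivative f (at x) = frechet_derivative g (at x)"
proof -
  have "(f has_derivative d) (at x) \<longleftrightarrow> (g has_derivative d) (at x)" for d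
    using assms has_derivative_transform_within_open[of _ d x UNIV S] by metis
  then show ?thesis
    unfolding frechet_derivative_def by presburger
qed

text \<open>
  Frechet derivatives at points of an open set only see the values of the map on that set, so the
  recursion defining \<^const>\<open>ck_on\<close> does as well.
\<close>

lemma ck_on_cong:
  assumes "open S" "\<And>x. x \<in> S \<Longrightarrow> f x = g x"
  shows "ck_on k S f \<longleftrightarrow> ck_on k S g"
  using assms(2)
proof (induction k arbitrary: f g)
  case 0
  then show ?case by (simp cong: continuous_on_cong)
next
  case (Suc k)
  have "f differentiable (at x) \<longleftrightarrow> g differentiable (at x)" if "x \<in> S" for x
    using has_derivative_transform_within_open[of _ _ x UNIV S] \<open>open S\<close> that Suc.prems
    unfolding differentiable_def by metis
  moreover have "ck_on k S (\<lambda>x. frechet_derivative f (at x) v)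
      \<longleftrightarrow> ck_on k S (\<lambda>x. frechet_derivative g (at x) v)" for v
    using frechet_derivative_cong_open[OF \<open>open S\<close> _ Suc.prems]
    by (intro Suc.IH) simp
  ultimately show ?case by auto
qed

lemma ck_on_subset: "ck_on k S f \<Longrightarrow> T \<subseteq> S \<Longrightarrow> ck_on k T f"
  by (induction k arbitrary: f) (auto intro: continuous_on_subset)

lemma ck_on_SucI:
  assumes "open S" and "\<And>x. x \<in> S \<Longrightarrow> (f has_derivative f' x) (at x)"
    and "\<And>v. ck_on k S (\<lambda>x. f' x v)"
  shows "ck_on (Suc k) S f"
proof -
  have "frechet_derivative f (at x) = f' x" if "x \<in> S" for x
    using frechet_derivative_at[OF assms(2)[OF that]] by simp
  then have "ck_on k S (\<lambda>x. frechet_derivative f (at x) v)" for v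
    using assms(3)[of v] ck_on_cong[OF assms(1), of "\<lambda>x. frechet_derivative f (at x) v"]
    by simp
  then show ?thesis
    using assms(2) by (auto simp: differentiable_def)
qed

lemma ck_on_SucD:
  assumes "ck_on (Suc k) S f"
  shows "x \<in> S \<Longrightarrow> (f has_derivative frechet_derivative f (at x)) (at x)"
    and "ck_on k S (\<lambda>x. frechet_derivative f (at x) v)"
  using assms by (auto simp: frechet_derivative_works)

lemma ck_on_lower: "ck_on (Suc k) S f \<Longrightarrow> ck_on k S f"
proof (induction k arbitrary: f)
  case 0
  then show ?case
    by (auto intro!: continuous_at_imp_continuous_on differentiable_imp_continuous_within)
next
  case (Suc k)
  have "ck_on k S (\<lambda>x. frechet_derivative f (at x) v)" for v
    using ck_on_SucD(2)[OF Suc.prems] by (rule Suc.IH)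
  then show ?case using Suc.prems by simp
qed

lemma ck_on_const: "open S \<Longrightarrow> ck_on k S (\<lambda>x. c)"
  by (induction k arbitrary: c) auto

lemma ck_on_bounded_linear:
  assumes "open S" "bounded_linear h"
  shows "ck_on k S h"
proof (cases k)
  case 0
  then show ?thesis using assms by (simp add: linear_continuous_on)
next
  case (Suc n)
  then show ?thesis
    unfolding Suc using assms
    by (intro ck_on_SucI[where f' = "\<lambda>x. h"] ck_on_const bounded_linear_imp_has_derivative)
qed

lemma ck_on_linear_image:
  assumes "open S" "bounded_linear h" "ck_on k S f"
  shows "ck_on k S (\<lambda>x. h (f x))"
  using assms(3)
proof (induction k arbitrary: f)
  case 0
  then show ?case using bounded_linear.continuous_on[OF assms(2)] by simp
next
  case (Suc k)
  show ?case
    by (rule ck_on_SucI[OF assms(1), where f' = "\<lambda>x v. h (frechet_derivative f (at x) v)"])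
      (auto intro!: bounded_linear.has_derivative[OF assms(2)] ck_on_SucD[OF Suc.prems] Suc.IH)
qed

lemma ck_on_add:
  assumes "open S" "ck_on k S f" "ck_on k S g"
  shows "ck_on k S (\<lambda>x. f x + g x)"
  using assms(2,3)
proof (induction k arbitrary: f g)
  case 0
  then show ?case by (auto intro: continuous_on_add)
next
  case (Suc k)
  show ?case
    by (rule ck_on_SucI[OF assms(1),
          where f' = "\<lambda>x v. frechet_derivative f (at x) v + frechet_derivative g (at x) v"])
      (auto intro!: has_derivative_add ck_on_SucD[OF Suc.prems(1)] ck_on_SucD[OF Suc.prems(2)] Suc.IH)
qed

lemma ck_on_sum:
  assumes "open S" "\<And>i. i \<in> I \<Longrightarrow> ck_on k S (f i)"
  shows "ck_on k S (\<lambda>x. \<Sum>i\<in>I. f i x)"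
  using assms(2)
  by (induction I rule: infinite_finite_induct) (auto intro!: ck_on_const ck_on_add assms(1))

lemma ck_on_scaleR:
  fixes f :: "'a::real_normed_vector \<Rightarrow> real"
  assumes "open S" "ck_on k S f" "ck_on k S g"
  shows "ck_on k S (\<lambda>x. f x *\<^sub>R g x)"
  using assms(2,3)
proof (induction k arbitrary: f g)
  case 0
  then show ?case by (auto intro: continuous_on_scaleR)
next
  case (Suc k)
  show ?case
    by (rule ck_on_SucI[OF assms(1), where
          f' = "\<lambda>x v. f x *\<^sub>R frechet_derivative g (at x) v + frechet_derivative f (at x) v *\<^sub>R g x"])
      (auto intro!: has_derivative_scaleR ck_on_add[OF assms(1)] Suc.IH ck_on_SucD[OF Suc.prems(1)]
        ck_on_SucD[OF Suc.prems(2)] ck_on_lower[OF Suc.prems(1)] ck_on_lower[OF Suc.prems(2)])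
qed

lemma ck_on_Pair:
  assumes "open S" "ck_on k S f" "ck_on k S g"
  shows "ck_on k S (\<lambda>x. (f x, g x))"
proof -
  have 1: "bounded_linear (\<lambda>y. (y, 0))" and 2: "bounded_linear (\<lambda>y. (0, y))"
    by (auto intro: bounded_linear_Pair bounded_linear_ident bounded_linear_zero)
  have "ck_on k S (\<lambda>x. (f x, 0) + (0, g x))"
    using ck_on_linear_image[OF assms(1) 1 assms(2)] ck_on_linear_image[OF assms(1) 2 assms(3)]
    by (intro ck_on_add[OF assms(1)])
  then show ?thesis by simp
qed

lemma linear_eq_sum_Basis:
  fixes h :: "'a::euclidean_space \<Rightarrow> 'b::real_vector"
  assumes "linear h"
  shows "h v = (\<Sum>b\<in>Basis. (v \<bullet> b) *\<^sub>R h b)"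
proof -
  have "h v = h (\<Sum>b\<in>Basis. (v \<bullet> b) *\<^sub>R b)"
    by (simp add: euclidean_representation)
  also have "\<dots> = (\<Sum>b\<in>Basis. (v \<bullet> b) *\<^sub>R h b)"
    using assms by (simp add: linear_sum linear_scale)
  finally show ?thesis .
qed

text \<open>
  Expanding the argument in the standard basis turns the application of a linear map that depends
  on a parameter into a finite sum of products. Smoothness of the linear map for each fixed
  argument is therefore enough.
\<close>

lemma ck_on_apply:
  fixes A :: "'a::real_normed_vector \<Rightarrow> 'f::euclidean_space \<Rightarrow> 'b::real_normed_vector"
  assumes "open S" "\<And>x. x \<in> S \<Longrightarrow> linear (A x)" "\<And>v. ck_on k S (\<lambda>x. A x v)" "ck_on k S w"
  shows "ck_on k S (\<lambda>x. A x (w x))"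
proof -
  have "ck_on k S (\<lambda>x. \<Sum>b\<in>Basis. (w x \<bullet> b) *\<^sub>R A x b)"
    using assms(3,4) ck_on_linear_image[OF assms(1) bounded_linear_inner_left]
    by (intro ck_on_sum ck_on_scaleR assms(1)) auto
  moreover have "A x (w x) = (\<Sum>b\<in>Basis. (w x \<bullet> b) *\<^sub>R A x b)" if "x \<in> S" for x
    using linear_eq_sum_Basis[OF assms(2)[OF that]] .
  ultimately show ?thesis
    by (simp add: ck_on_cong[OF assms(1), of "\<lambda>x. A x (w x)" "\<lambda>x. \<Sum>b\<in>Basis. (w x \<bullet> b) *\<^sub>R A x b"])
qed

lemma ck_on_compose:
  fixes f :: "'a::real_normed_vector \<Rightarrow> 'f::euclidean_space" and g :: "'f \<Rightarrow> 'b::real_normed_vector"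
  assumes "open S" "open T" "f ` S \<subseteq> T" "ck_on k S f" "ck_on k T g"
  shows "ck_on k S (\<lambda>x. g (f x))"
  using assms(4,5)
proof (induction k arbitrary: g)
  case 0
  then show ?case using assms(3) by (auto intro: continuous_on_compose2)
next
  case (Suc k)
  have T: "f x \<in> T" if "x \<in> S" for x using assms(3) that by auto
  show ?case
  proof (rule ck_on_SucI[OF assms(1), where
        f' = "\<lambda>x v. frechet_derivative g (at (f x)) (frechet_derivative f (at x) v)"])
    show "((\<lambda>x. g (f x)) has_derivative
        (\<lambda>v. frechet_derivative g (at (f x)) (frechet_derivative f (at x) v))) (at x)" if "x \<in> S" for x
      using has_derivative_compose[OF ck_on_SucD(1)[OF Suc.prems(1) that]
          ck_on_SucD(1)[OF Suc.prems(2) T[OF that]]] .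
    show "ck_on k S (\<lambda>x. frechet_derivative g (at (f x)) (frechet_derivative f (at x) v))" for v
    proof (rule ck_on_apply[OF assms(1), where A = "\<lambda>x. frechet_derivative g (at (f x))"
          and w = "\<lambda>x. frechet_derivative f (at x) v"])
      show "linear (frechet_derivative g (at (f x)))" if "x \<in> S" for x
        using ck_on_SucD(1)[OF Suc.prems(2) T[OF that]] has_derivative_linear by blast
      show "ck_on k S (\<lambda>x. frechet_derivative g (at (f x)) v)" for v
        using Suc.IH[OF ck_on_lower[OF Suc.prems(1)] ck_on_SucD(2)[OF Suc.prems(2)]] .
      show "ck_on k S (\<lambda>x. frechet_derivative f (at x) v)"
        using ck_on_SucD(2)[OF Suc.prems(1)] .
    qed
  qed
qed

text \<open>
  A factor that tends to \<open>0\<close> times a factor of order \<open>\<parallel>h\<parallel>\<close> is of smaller order than \<open>\<parallel>h\<parallel>\<close>.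
\<close>

lemma has_derivative_scaleR_vanishing:
  fixes f :: "'a::real_normed_vector \<Rightarrow> real"
  assumes "isCont f x" "f x = 0" and g: "(g has_derivative g') (at x)" and "g x = 0"
  shows "((\<lambda>y. f y *\<^sub>R g y) has_derivative (\<lambda>h. 0)) (at x)"
proof -
  have lin: "bounded_linear g'" using g by (rule has_derivative_bounded_linear)
  obtain K where K: "\<And>h. norm (g' h) \<le> norm h * K"
    using bounded_linear.bounded[OF lin] by blast
  have f0: "(\<lambda>h. f (x + h)) \<midarrow>0\<rightarrow> 0"
    using assms(1,2) by (simp add: isCont_iff)
  have r0: "(\<lambda>h. norm (g (x + h) - g x - g' h) / norm h) \<midarrow>0\<rightarrow> 0"
    using g by (simp add: has_derivative_at)
  have "(\<lambda>h. \<bar>f (x + h)\<bar> * (norm (g (x + h) - g x - g' h) / norm h + K)) \<midarrow>0\<rightarrow> \<bar>0\<bar> * (0 + K)"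
    by (intro tendsto_intros f0 r0)
  then have lim: "(\<lambda>h. \<bar>f (x + h)\<bar> * (norm (g (x + h) - g x - g' h) / norm h + K)) \<midarrow>0\<rightarrow> 0"
    by simp
  have "norm (f (x + h) *\<^sub>R g (x + h)) / norm h
      \<le> \<bar>f (x + h)\<bar> * (norm (g (x + h) - g x - g' h) / norm h + K)" if "h \<noteq> 0" for h
  proof -
    have "norm (g (x + h)) \<le> norm (g (x + h) - g x - g' h) + norm (g' h)"
      using norm_triangle_ineq[of "g (x + h) - g x - g' h" "g' h"] assms(4) by simp
    also have "\<dots> \<le> norm (g (x + h) - g x - g' h) + norm h * K"
      using K by simp
    finally have "norm (g (x + h)) / norm h \<le> norm (g (x + h) - g x - g' h) / norm h + K"
      using that by (simp add: field_simps)
    from mult_left_mono[OF this, of "\<bar>f (x + h)\<bar>"] show ?thesis by simp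
  qed
  then have "(\<lambda>h. norm (f (x + h) *\<^sub>R g (x + h)) / norm h) \<midarrow>0\<rightarrow> 0"
    by (intro tendsto_sandwich[OF _ _ tendsto_const lim]) (auto simp: eventually_at_filter)
  then show ?thesis
    using assms(2) by (simp add: has_derivative_at)
qed

text \<open>
  Injectivity at \<open>x\<close> gives a lower bound \<open>c \<parallel>v\<parallel> \<le> \<parallel>A x v\<parallel>\<close>, which survives with \<open>c / 2\<close> at nearby points
  \<open>y\<close>. Applied to \<open>v = w y - w x\<close> it bounds the increment of \<open>w\<close> by \<open>2 / c\<close> times
  \<open>\<parallel>A y (w y) - A y (w x)\<parallel>\<close>, which tends to \<open>0\<close>.
\<close>

lemma continuous_linear_system_solution:
  fixes A :: "'a::real_normed_vector \<Rightarrow> 'f::euclidean_space \<Rightarrow> 'f"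
  assumes S: "open S" and A: "\<And>x. x \<in> S \<Longrightarrow> linear (A x)" "\<And>x. x \<in> S \<Longrightarrow> inj (A x)"
    and contA: "\<And>v. continuous_on S (\<lambda>x. A x v)"
    and contr: "continuous_on S (\<lambda>x. A x (w x))"
  shows "continuous_on S w"
proof (intro continuous_at_imp_continuous_on ballI)
  fix x assume x: "x \<in> S"
  obtain c where c: "c > 0" "\<And>v. c * norm v \<le> norm (A x v)"
    using linear_inj_bounded_below_pos[OF A(1)[OF x] A(2)[OF x]] by blast
  have isA: "isCont (\<lambda>y. A y v) x" for v
    using contA S x by (simp add: continuous_on_eq_continuous_at)
  have isr: "isCont (\<lambda>y. A y (w y)) x"
    using contr S x by (simp add: continuous_on_eq_continuous_at)
  have "((\<lambda>y. \<Sum>b\<in>Basis. norm (A y b - A x b)) \<longlongrightarrow> (\<Sum>b\<in>(Basis::'f set). norm (A x b - A x b))) (at x)"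
    using isA by (intro tendsto_intros) (simp add: isCont_def)
  then have "\<forall>\<^sub>F y in at x. (\<Sum>b\<in>Basis. norm (A y b - A x b)) < c / 2"
    using c(1) by (intro order_tendstoD(2)) auto
  then have ev: "\<forall>\<^sub>F y in at x. y \<in> S \<and> (\<Sum>b\<in>Basis. norm (A y b - A x b)) < c / 2"
    using S x by (auto intro: eventually_conj eventually_at_in_open')
  have bound: "norm (w y - w x) \<le> 2 / c * norm (A y (w y) - A y (w x))"
    if y: "y \<in> S" "(\<Sum>b\<in>Basis. norm (A y b - A x b)) < c / 2" for y
  proof -
    let ?v = "w y - w x"
    have "A y ?v - A x ?v = (\<Sum>b\<in>Basis. (?v \<bullet> b) *\<^sub>R (A y b - A x b))"
      using linear_eq_sum_Basis[OF A(1)[OF y(1)], of ?v] linear_eq_sum_Basis[OF A(1)[OF x], of ?v]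
      by (simp add: sum_subtractf scaleR_diff_right)
    also have "norm \<dots> \<le> (\<Sum>b\<in>Basis. norm ?v * norm (A y b - A x b))"
      by (intro sum_norm_le) (auto intro!: mult_right_mono simp: Basis_le_norm)
    also have "\<dots> = norm ?v * (\<Sum>b\<in>Basis. norm (A y b - A x b))"
      by (simp add: sum_distrib_left)
    also have "\<dots> \<le> norm ?v * (c / 2)"
      using y(2) by (intro mult_left_mono) auto
    finally have "norm (A y ?v - A x ?v) \<le> norm ?v * (c / 2)" .
    moreover have "c * norm ?v \<le> norm (A y ?v) + norm (A y ?v - A x ?v)"
      using c(2)[of ?v] norm_triangle_ineq4[of "A y ?v" "A y ?v - A x ?v"] by simp
    ultimately have "norm ?v * (c / 2) \<le> norm (A y ?v)" by (simp add: algebra_simps)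
    also have "A y ?v = A y (w y) - A y (w x)" using A(1)[OF y(1)] by (simp add: linear_diff)
    finally show ?thesis using c(1) by (simp add: field_simps)
  qed
  have "((\<lambda>y. 2 / c * norm (A y (w y) - A y (w x))) \<longlongrightarrow> 2 / c * norm (A x (w x) - A x (w x))) (at x)"
    using isr isA by (intro tendsto_intros) (auto simp: isCont_def)
  then have lim: "((\<lambda>y. 2 / c * norm (A y (w y) - A y (w x))) \<longlongrightarrow> 0) (at x)"
    by simp
  have "\<forall>\<^sub>F y in at x. norm (w y - w x) \<le> 2 / c * norm (A y (w y) - A y (w x))"
    using ev by (rule eventually_mono) (use bound in blast)
  then have "((\<lambda>y. w y - w x) \<longlongrightarrow> 0) (at x)"
    using lim by (rule Lim_null_comparison)
  then show "isCont w x"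
    unfolding isCont_def by (subst Lim_null)
qed

text \<open>
  With a left inverse \<open>B\<close> of \<open>A x\<close> one has
  \<open>w y = w x + B (A y (w y) - A y (w x) - (A y - A x) (w y - w x))\<close>.
  The last term is a product of a continuous and a differentiable factor that both vanish at \<open>x\<close>,
  hence differentiable although nothing but continuity is known about \<open>w\<close>.
\<close>

lemma differentiable_linear_system_solution:
  fixes A :: "'a::real_normed_vector \<Rightarrow> 'f::euclidean_space \<Rightarrow> 'f"
  assumes S: "open S" "x \<in> S" and A: "\<And>x. x \<in> S \<Longrightarrow> linear (A x)" "inj (A x)"
    and diffA: "\<And>v. (\<lambda>y. A y v) differentiable (at x)"
    and diffr: "(\<lambda>y. A y (w y)) differentiable (at x)"
    and contw: "isCont w x"
  shows "w differentiable (at x)"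
proof -
  obtain B where B: "linear B" "\<And>v. B (A x v) = v"
    using linear_injective_left_inverse[OF A(1)[OF S(2)] A(2)] by (metis comp_apply id_apply)
  have bl: "bounded_linear B" using B(1) by (simp add: linear_conv_bounded_linear)
  let ?p = "\<lambda>y b. ((w y - w x) \<bullet> b) *\<^sub>R (A y b - A x b)"
  have 1: "w y = w x + B (A y (w y) - A y (w x) - (\<Sum>b\<in>Basis. ?p y b))" if y: "y \<in> S" for y
  proof -
    let ?v = "w y - w x"
    have "A y ?v - A x ?v = (\<Sum>b\<in>Basis. ?p y b)"
      using linear_eq_sum_Basis[OF A(1)[OF y(1)], of ?v] linear_eq_sum_Basis[OF A(1)[OF S(2)], of ?v]
      by (simp add: sum_subtractf scaleR_diff_right)
    moreover have "A y ?v = A y (w y) - A y (w x)" using A(1)[OF y] by (simp add: linear_diff)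
    ultimately have "A x ?v = A y (w y) - A y (w x) - (\<Sum>b\<in>Basis. ?p y b)" by (simp add: algebra_simps)
    then show ?thesis using B(2)[of ?v] by simp
  qed
  have p: "(\<lambda>y. ?p y b) differentiable (at x)" for b
  proof -
    have "(\<lambda>y. A y b - A x b) differentiable (at x)" using diffA by auto
    then obtain d where "((\<lambda>y. A y b - A x b) has_derivative d) (at x)"
      unfolding differentiable_def by blast
    then have "((\<lambda>y. ?p y b) has_derivative (\<lambda>h. 0)) (at x)"
      using contw by (intro has_derivative_scaleR_vanishing[where g' = d]) (auto intro!: continuous_intros)
    then show ?thesis unfolding differentiable_def by blast
  qed
  have "(\<lambda>y. w x + B (A y (w y) - A y (w x) - (\<Sum>b\<in>Basis. ?p y b))) differentiable (at x)"
    using diffA diffr p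
    by (intro differentiable_add differentiable_const differentiable_diff differentiable_sum
      differentiable_compose[OF bounded_linear_imp_differentiable[OF bl]]) auto
  then obtain d where "((\<lambda>y. w x + B (A y (w y) - A y (w x) - (\<Sum>b\<in>Basis. ?p y b))) has_derivative d) (at x)"
    unfolding differentiable_def by blast
  then have "(w has_derivative d) (at x)"
    by (rule has_derivative_transform_within_open[OF _ S]) (metis 1)
  then show ?thesis unfolding differentiable_def by blast
qed

text \<open>
  The solution of a linear system depends on parameters as smoothly as the coefficients and the
  right-hand side. Differentiating \<open>A w = r\<close> shows that the derivative of \<open>w\<close> solves the system
  \<open>A w' = r' - A' w\<close> with the same coefficients, and its right-hand side is one degree less
  smooth; induction on the degree applies to it.
\<close>

lemma ck_on_linear_system_solution:
  fixes A :: "'a::real_normed_vector \<Rightarrow> 'f::euclidean_space \<Rightarrow> 'f"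
  assumes S: "open S" and A: "\<And>x. x \<in> S \<Longrightarrow> linear (A x)" "\<And>x. x \<in> S \<Longrightarrow> inj (A x)"
    and "\<And>v. ck_on k S (\<lambda>x. A x v)" and "ck_on k S (\<lambda>x. A x (w x))"
  shows "ck_on k S w"
  using assms(4,5)
proof (induction k arbitrary: w)
  case 0
  then show ?case using continuous_linear_system_solution[OF S A] by simp
next
  case (Suc k)
  have ckw: "ck_on k S w"
    using ck_on_lower[OF Suc.prems(1)] ck_on_lower[OF Suc.prems(2)] by (rule Suc.IH)
  have "ck_on 0 S f" if "ck_on n S f" for n and f :: "'a \<Rightarrow> 'f"
    using that by (induction n) (auto dest: ck_on_lower simp del: ck_on.simps)
  then have "continuous_on S w" using ckw by (metis ck_on.simps(1))
  then have contw: "isCont w x" if "x \<in> S" for x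
    using S that by (simp add: continuous_on_eq_continuous_at)
  have diffA: "(\<lambda>y. A y v) differentiable (at x)" "(\<lambda>y. A y (w y)) differentiable (at x)"
    if "x \<in> S" for x v
    using Suc.prems that by (simp_all only: ck_on.simps)
  have diffw: "w differentiable (at x)" if "x \<in> S" for x
    using A(1) A(2)[OF that] diffA[OF that] contw[OF that]
    by (rule differentiable_linear_system_solution[OF S that])
  let ?Dr = "\<lambda>x v. frechet_derivative (\<lambda>x. A x (w x)) (at x) v"
  let ?DA = "\<lambda>b x v. frechet_derivative (\<lambda>x. A x b) (at x) v"
  let ?Dw = "\<lambda>x v. frechet_derivative w (at x) v"
  have key: "A x (?Dw x v) = ?Dr x v - (\<Sum>b\<in>Basis. (w x \<bullet> b) *\<^sub>R ?DA b x v)" if x: "x \<in> S" for x v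
  proof -
    have w: "(w has_derivative ?Dw x) (at x)" using diffw[OF x] by (simp add: frechet_derivative_works)
    have "((\<lambda>y. \<Sum>b\<in>Basis. (w y \<bullet> b) *\<^sub>R A y b) has_derivative
        (\<lambda>v. \<Sum>b\<in>Basis. (w x \<bullet> b) *\<^sub>R ?DA b x v + (?Dw x v \<bullet> b) *\<^sub>R A x b)) (at x)"
      by (intro has_derivative_sum has_derivative_scaleR has_derivative_inner_left w
          ck_on_SucD(1)[OF Suc.prems(1) x])
    then have "((\<lambda>y. A y (w y)) has_derivative
        (\<lambda>v. \<Sum>b\<in>Basis. (w x \<bullet> b) *\<^sub>R ?DA b x v + (?Dw x v \<bullet> b) *\<^sub>R A x b)) (at x)"
      by (rule has_derivative_transform_within_open[OF _ S x]) (simp add: linear_eq_sum_Basis[OF A(1), symmetric])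
    then have "?Dr x v = (\<Sum>b\<in>Basis. (w x \<bullet> b) *\<^sub>R ?DA b x v + (?Dw x v \<bullet> b) *\<^sub>R A x b)"
      by (rule fun_cong[OF frechet_derivative_at[symmetric]])
    then show ?thesis
      using linear_eq_sum_Basis[OF A(1)[OF x], of "?Dw x v"] by (simp add: sum.distrib)
  qed
  have "ck_on k S (\<lambda>x. ?Dw x v)" for v
  proof (rule Suc.IH)
    show "ck_on k S (\<lambda>x. A x v)" for v using ck_on_lower[OF Suc.prems(1)] .
    have "ck_on k S (\<lambda>x. ?Dr x v + (\<Sum>b\<in>Basis. (- (w x \<bullet> b)) *\<^sub>R ?DA b x v))"
      by (intro ck_on_add ck_on_sum ck_on_scaleR S ck_on_SucD(2)[OF Suc.prems(1)]
        ck_on_SucD(2)[OF Suc.prems(2)] ck_on_linear_image[OF S _ ckw, of "\<lambda>w. - (w \<bullet> b)" for b]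
        bounded_linear_minus bounded_linear_inner_left)
    then show "ck_on k S (\<lambda>x. A x (?Dw x v))"
      using ck_on_cong[OF S key] by (simp add: sum_negf)
  qed
  then show ?case using diffw by simp
qed

lemma smooth_on_cong:
  assumes "open S" "\<And>x. x \<in> S \<Longrightarrow> f x = g x"
  shows "smooth_on S f \<longleftrightarrow> smooth_on S g"
  unfolding smooth_on_def using ck_on_cong[OF assms] by simp

lemma smooth_on_subset: "smooth_on S f \<Longrightarrow> T \<subseteq> S \<Longrightarrow> smooth_on T f"
  unfolding smooth_on_def using ck_on_subset by blast

lemma smooth_on_has_derivative:
  "smooth_on S f \<Longrightarrow> x \<in> S \<Longrightarrow> (f has_derivative frechet_derivative f (at x)) (at x)"
  unfolding smooth_on_def using ck_on_SucD(1) by blast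

lemma smooth_on_derivative:
  "smooth_on S f \<Longrightarrow> smooth_on S (\<lambda>x. frechet_derivative f (at x) v)"
  unfolding smooth_on_def using ck_on_SucD(2) by blast

lemma smooth_on_const: "open S \<Longrightarrow> smooth_on S (\<lambda>x. c)"
  unfolding smooth_on_def using ck_on_const by blast

lemma smooth_on_bounded_linear: "open S \<Longrightarrow> bounded_linear h \<Longrightarrow> smooth_on S h"
  unfolding smooth_on_def using ck_on_bounded_linear by blast

lemma smooth_on_linear_image:
  "open S \<Longrightarrow> bounded_linear h \<Longrightarrow> smooth_on S f \<Longrightarrow> smooth_on S (\<lambda>x. h (f x))"
  unfolding smooth_on_def using ck_on_linear_image by blast

lemma smooth_on_add:
  "open S \<Longrightarrow> smooth_on S f \<Longrightarrow> smooth_on S g \<Longrightarrow> smooth_on S (\<lambda>x. f x + g x)"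
  unfolding smooth_on_def using ck_on_add by blast

lemma smooth_on_Pair:
  "open S \<Longrightarrow> smooth_on S f \<Longrightarrow> smooth_on S g \<Longrightarrow> smooth_on S (\<lambda>x. (f x, g x))"
  unfolding smooth_on_def using ck_on_Pair by blast

lemma smooth_on_compose:
  fixes f :: "'a::real_normed_vector \<Rightarrow> 'f::euclidean_space" and g :: "'f \<Rightarrow> 'b::real_normed_vector"
  assumes "open S" "open T" "f ` S \<subseteq> T" "smooth_on S f" "smooth_on T g"
  shows "smooth_on S (\<lambda>x. g (f x))"
  using assms(4,5) unfolding smooth_on_def
  by (intro allI ck_on_compose[where g = g and f = f, OF assms(1-3)]) simp_all

lemma smooth_on_apply:
  fixes A :: "'a::real_normed_vector \<Rightarrow> 'f::euclidean_space \<Rightarrow> 'b::real_normed_vector"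
  assumes "open S" "\<And>x. x \<in> S \<Longrightarrow> linear (A x)" "\<And>v. smooth_on S (\<lambda>x. A x v)" "smooth_on S w"
  shows "smooth_on S (\<lambda>x. A x (w x))"
  using assms(3,4) unfolding smooth_on_def
  by (intro allI ck_on_apply[where A = A and w = w, OF assms(1,2)]) simp_all

lemma smooth_on_derivative_along:
  fixes f :: "'f::euclidean_space \<Rightarrow> 'b::real_normed_vector"
  assumes "open S" "open T" "g ` S \<subseteq> T" "smooth_on S g" "smooth_on T f" "smooth_on S w"
  shows "smooth_on S (\<lambda>x. frechet_derivative f (at (g x)) (w x))"
proof (rule smooth_on_apply[where A = "\<lambda>x. frechet_derivative f (at (g x))", OF assms(1) _ _ assms(6)])
  show "linear (frechet_derivative f (at (g x)))" if "x \<in> S" for x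
    using that assms(3) smooth_on_has_derivative[OF assms(5)] has_derivative_linear by blast
  show "smooth_on S (\<lambda>x. frechet_derivative f (at (g x)) v)" for v
    using smooth_on_compose[OF assms(1-4) smooth_on_derivative[OF assms(5)]] .
qed

lemma smooth_on_linear_system_solution:
  fixes A :: "'a::real_normed_vector \<Rightarrow> 'f::euclidean_space \<Rightarrow> 'f"
  assumes "open S" "\<And>x. x \<in> S \<Longrightarrow> linear (A x)" "\<And>x. x \<in> S \<Longrightarrow> inj (A x)"
    and "\<And>v. smooth_on S (\<lambda>x. A x v)" and "smooth_on S (\<lambda>x. A x (w x))"
  shows "smooth_on S w"
  using assms(4,5) unfolding smooth_on_def
  by (intro allI ck_on_linear_system_solution[where A = A and w = w, OF assms(1-3)]) simp_all

text \<open>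
  A directional derivative can be read off from the restriction to a line. This computes derivatives
  in vertical directions, in which all maps of interest have a simple form.
\<close>

lemma frechet_derivative_along_line:
  assumes "f differentiable (at x)" and "((\<lambda>t. f (x + t *\<^sub>R v)) has_vector_derivative d) (at 0)"
  shows "frechet_derivative f (at x) v = d"
proof -
  have f: "(f has_derivative frechet_derivative f (at x)) (at (x + 0 *\<^sub>R v))"
    using assms(1) by (simp add: frechet_derivative_works)
  have line: "((\<lambda>t. x + t *\<^sub>R v) has_derivative (\<lambda>t. t *\<^sub>R v)) (at 0)"
    by (auto intro!: derivative_eq_intros)
  have "((\<lambda>t. f (x + t *\<^sub>R v)) has_derivative (\<lambda>t. frechet_derivative f (at x) (t *\<^sub>R v))) (at 0)"
    using has_derivative_compose[OF line f] .
  moreover have "(\<lambda>t. frechet_derivative f (at x) (t *\<^sub>R v)) = (\<lambda>t. t *\<^sub>R frechet_derivative f (at x) v)"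
    using has_derivative_linear[OF f] by (simp add: linear_scale)
  ultimately have "((\<lambda>t. f (x + t *\<^sub>R v)) has_vector_derivative frechet_derivative f (at x) v) (at 0)"
    by (simp add: has_vector_derivative_def)
  then show ?thesis
    using assms(2) vector_derivative_unique_at by blast
qed

section \<open>Atlases and tangent vectors in coordinates\<close>

text \<open>
  The local part of the notion of a manifold, in a form that passes to the slit tangent bundle by
  a computation in charts.
\<close>

definition atlas :: "('m, 'i, 'e::euclidean_space) mfd \<Rightarrow> bool" where
  "atlas N \<longleftrightarrow>
     pts N = (\<Union>i. cdom N i) \<and>
     (\<forall>i. inj_on (chart N i) (cdom N i)) \<and>
     (\<forall>i j. open (chart N i ` (cdom N i \<inter> cdom N j)) \<and>
            smooth_on (chart N i ` (cdom N i \<inter> cdom N j)) (chart N j \<circ> cinv N i))"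

lemma manifold_imp_atlas: "manifold M \<Longrightarrow> atlas M"
  by (simp add: manifold_def atlas_def)

definition jac :: "('m, 'i, 'e::euclidean_space) mfd \<Rightarrow> 'i \<Rightarrow> 'i \<Rightarrow> 'm \<Rightarrow> 'e \<Rightarrow> 'e"
  where "jac N i j p = frechet_derivative (chart N j \<circ> cinv N i) (at (chart N i p))"

text \<open>
  For \<open>p\<close> in the domain of chart \<open>i\<close>, this is the unique tangent vector whose component in that
  chart is \<open>v\<close>; as a function of \<open>p\<close> it is a constant combination of the coordinate fields.
\<close>

definition coordvec :: "('m, 'i, 'e::euclidean_space) mfd \<Rightarrow> 'i \<Rightarrow> 'm \<Rightarrow> 'e \<Rightarrow> ('i \<Rightarrow> 'e)"
  where "coordvec N i p v = (\<lambda>j. if p \<in> cdom N j then jac N i j p v else 0)"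

lemma cinv_image:
  assumes "z \<in> chart N i ` cdom N i"
  shows "cinv N i z \<in> cdom N i" and "chart N i (cinv N i z) = z"
  using assms unfolding cinv_def by (auto intro: inv_into_into f_inv_into_f)

lemma tspaceI:
  assumes "\<And>i. p \<notin> cdom N i \<Longrightarrow> v i = 0"
    and "\<And>i j. p \<in> cdom N i \<Longrightarrow> p \<in> cdom N j \<Longrightarrow> v j = jac N i j p (v i)"
  shows "v \<in> tspace N p"
  unfolding tspace_def using assms by (simp add: jac_def)

lemma tspace_zero: "v \<in> tspace N p \<Longrightarrow> p \<notin> cdom N i \<Longrightarrow> v i = 0"
  unfolding tspace_def by simp

lemma tspace_jac:
  "v \<in> tspace N p \<Longrightarrow> p \<in> cdom N i \<Longrightarrow> p \<in> cdom N j \<Longrightarrow> v j = jac N i j p (v i)"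
  unfolding tspace_def jac_def by blast

context
  fixes N :: "('m, 'i, 'e::euclidean_space) mfd"
  assumes atlas: "atlas N"
begin

lemma atlas_cinv_chart: "p \<in> cdom N i \<Longrightarrow> cinv N i (chart N i p) = p"
  using atlas by (auto simp: atlas_def cinv_def)

lemma atlas_chart_eq_iff:
  "p \<in> cdom N i \<Longrightarrow> q \<in> cdom N i \<Longrightarrow> chart N i p = chart N i q \<longleftrightarrow> p = q"
  using atlas by (meson atlas_def inj_on_eq_iff)

lemma atlas_cdom_subset: "cdom N i \<subseteq> pts N"
  using atlas by (auto simp: atlas_def)

lemma atlas_pts_chart: "p \<in> pts N \<Longrightarrow> \<exists>i. p \<in> cdom N i"
  using atlas by (auto simp: atlas_def)

lemma atlas_open_overlap: "open (chart N i ` (cdom N i \<inter> cdom N j))"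
  using atlas by (simp add: atlas_def)

lemma atlas_open_image: "open (chart N i ` cdom N i)"
  using atlas_open_overlap[of i i] by simp

lemma atlas_smooth_transition:
  "smooth_on (chart N i ` (cdom N i \<inter> cdom N j)) (chart N j \<circ> cinv N i)"
  using atlas by (simp add: atlas_def)

lemma mopen_cdom: "mopen N (cdom N i)"
  using atlas_cdom_subset atlas_open_overlap[of _ i] by (simp add: mopen_def Int_commute)

lemma mopen_pts: "mopen N (pts N)"
  using atlas_cdom_subset atlas_open_image by (simp add: mopen_def Int_absorb1)

lemma mopen_Int: "mopen N V \<Longrightarrow> mopen N W \<Longrightarrow> mopen N (V \<inter> W)"
proof -
  assume VW: "mopen N V" "mopen N W"
  have "chart N i ` (V \<inter> W \<inter> cdom N i) = chart N i ` (V \<inter> cdom N i) \<inter> chart N i ` (W \<inter> cdom N i)" for i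
    using inj_on_image_Int[of "chart N i" "cdom N i" "V \<inter> cdom N i" "W \<inter> cdom N i"] atlas
    by (simp add: atlas_def Int_ac)
  with VW show ?thesis unfolding mopen_def by auto
qed

lemma jac_has_derivative:
  assumes "p \<in> cdom N i" "p \<in> cdom N j"
  shows "((chart N j \<circ> cinv N i) has_derivative jac N i j p) (at (chart N i p))"
  unfolding jac_def using assms by (intro smooth_on_has_derivative[OF atlas_smooth_transition]) auto

lemma linear_jac: "p \<in> cdom N i \<Longrightarrow> p \<in> cdom N j \<Longrightarrow> linear (jac N i j p)"
  using jac_has_derivative has_derivative_linear by blast

lemma jac_self:
  assumes "p \<in> cdom N i"
  shows "jac N i i p v = v"
proof -
  have "(id has_derivative jac N i i p) (at (chart N i p))"
    by (rule has_derivative_transform_within_open[OF jac_has_derivative[OF assms assms]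
          atlas_open_image[of i]])
      (use assms in \<open>auto simp: atlas_cinv_chart\<close>)
  from has_derivative_unique[OF this has_derivative_id] show ?thesis
    by simp
qed

lemma jac_jac:
  assumes "p \<in> cdom N i" "p \<in> cdom N j" "p \<in> cdom N k"
  shows "jac N j k p (jac N i j p v) = jac N i k p v"
proof -
  have j: "(chart N j \<circ> cinv N i) (chart N i p) = chart N j p"
    using assms by (simp add: atlas_cinv_chart)
  have "((\<lambda>z. (chart N k \<circ> cinv N j) ((chart N j \<circ> cinv N i) z)) has_derivative
      (\<lambda>v. jac N j k p (jac N i j p v))) (at (chart N i p))"
    using jac_has_derivative[OF assms(2,3)]
    by (intro has_derivative_compose[OF jac_has_derivative[OF assms(1,2)]]) (simp only: j)
  then have "((chart N k \<circ> cinv N i) has_derivative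
      (\<lambda>v. jac N j k p (jac N i j p v))) (at (chart N i p))"
    by (rule has_derivative_transform_within_open[OF _ atlas_open_overlap[of i j]])
      (use assms in \<open>auto simp: atlas_cinv_chart\<close>)
  from has_derivative_unique[OF this jac_has_derivative[OF assms(1,3)]]
  show ?thesis by (rule fun_cong)
qed

lemma smooth_on_jac:
  "smooth_on (chart N i ` (cdom N i \<inter> cdom N j)) (\<lambda>z. jac N i j (cinv N i z) v)"
proof -
  have "jac N i j (cinv N i z) v = frechet_derivative (chart N j \<circ> cinv N i) (at z) v"
    if "z \<in> chart N i ` (cdom N i \<inter> cdom N j)" for z
    using that by (auto simp: jac_def atlas_cinv_chart)
  then show ?thesis
    using smooth_on_derivative[OF atlas_smooth_transition]
      smooth_on_cong[OF atlas_open_overlap, of i j "\<lambda>z. jac N i j (cinv N i z) v"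
        "\<lambda>z. frechet_derivative (chart N j \<circ> cinv N i) (at z) v"] by simp
qed

lemma smooth_on_jac_apply:
  assumes "open S" "f ` S \<subseteq> chart N i ` (cdom N i \<inter> cdom N j)" "smooth_on S f" "smooth_on S w"
  shows "smooth_on S (\<lambda>x. jac N i j (cinv N i (f x)) (w x))"
proof (rule smooth_on_apply[where A = "\<lambda>x. jac N i j (cinv N i (f x))" and w = w])
  show "open S" "smooth_on S w" using assms by auto
  show "linear (jac N i j (cinv N i (f x)))" if "x \<in> S" for x
  proof -
    have "f x \<in> chart N i ` (cdom N i \<inter> cdom N j)" using that assms(2) by auto
    then obtain p where "p \<in> cdom N i" "p \<in> cdom N j" "f x = chart N i p" by auto
    then show ?thesis by (simp add: atlas_cinv_chart linear_jac)
  qed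
  show "smooth_on S (\<lambda>x. jac N i j (cinv N i (f x)) v)" for v
    by (rule smooth_on_compose[where g = "\<lambda>z. jac N i j (cinv N i z) v" and f = f,
          OF assms(1) atlas_open_overlap assms(2,3) smooth_on_jac])
qed

lemma coordvec_self: "p \<in> cdom N i \<Longrightarrow> coordvec N i p v i = v"
  by (simp add: coordvec_def jac_self)

lemma coordvec_in_tspace: "p \<in> cdom N i \<Longrightarrow> coordvec N i p v \<in> tspace N p"
  by (rule tspaceI) (simp_all add: coordvec_def jac_jac)

lemma tspace_eq_coordvec:
  assumes "v \<in> tspace N p" "p \<in> cdom N i"
  shows "v = coordvec N i p (v i)"
proof
  show "v j = coordvec N i p (v i) j" for j
    using tspace_zero[OF assms(1)] tspace_jac[OF assms(1,2)]
    unfolding coordvec_def by (cases "p \<in> cdom N j") auto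
qed

lemma tspace_eqI:
  assumes "v \<in> tspace N p" "w \<in> tspace N p" "p \<in> cdom N i" "v i = w i"
  shows "v = w"
  using tspace_eq_coordvec assms by metis

lemma subspace_tspace: "subspace (tspace N p)"
proof (rule subspaceI)
  show "0 \<in> tspace N p"
    by (rule tspaceI) (simp_all add: linear_0[OF linear_jac])
  fix v w r
  assume v: "v \<in> tspace N p" and w: "w \<in> tspace N p"
  have add: "v j + w j = jac N i j p (v i + w i)" and scale: "r *\<^sub>R v j = jac N i j p (r *\<^sub>R v i)"
    if "p \<in> cdom N i" "p \<in> cdom N j" for i j
    unfolding tspace_jac[OF v that] tspace_jac[OF w that]
    using linear_jac[OF that] by (simp_all only: linear_add linear_scale)
  show "v + w \<in> tspace N p"
    by (rule tspaceI, simp add: tspace_zero[OF v] tspace_zero[OF w])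
      (unfold plus_fun_apply, rule add)
  show "r *\<^sub>R v \<in> tspace N p"
    by (rule tspaceI, simp add: scaleR_fun_def tspace_zero[OF v])
      (unfold scaleR_fun_def, rule scale)
qed

lemma linear_coordvec: "p \<in> cdom N i \<Longrightarrow> linear (coordvec N i p)"
proof (intro linearI)
  assume p: "p \<in> cdom N i"
  show "coordvec N i p (a + b) = coordvec N i p a + coordvec N i p b" for a b
    using p by (auto simp: coordvec_def fun_eq_iff linear_add[OF linear_jac])
  show "coordvec N i p (r *\<^sub>R a) = r *\<^sub>R coordvec N i p a" for r a
    using p by (auto simp: coordvec_def scaleR_fun_def fun_eq_iff linear_scale[OF linear_jac])
qed

end

lemma cinv_open_sub:
  assumes "atlas N" "z \<in> chart N i ` (W \<inter> cdom N i)"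
  shows "cinv (open_sub N W) i z = cinv N i z"
proof -
  obtain p where p: "p \<in> W" "p \<in> cdom N i" "z = chart N i p" using assms(2) by auto
  have "inj_on (chart N i) (cdom N i \<inter> W)"
    using assms(1) inj_on_subset[of "chart N i" "cdom N i"] by (auto simp: atlas_def)
  then have "cinv (open_sub N W) i z = p"
    using p by (simp add: cinv_def open_sub_def)
  then show ?thesis using p atlas_cinv_chart[OF assms(1)] by simp
qed

section \<open>Smooth sections along a map\<close>

text \<open>
  The fields of interest are sections of a tangent bundle along a map \<open>f\<close> that matches the two
  atlases chart by chart: the identity for vector fields, and the projection of the slit bundle for
  \<open>\<pi>\<close>-vector fields. Smoothness asks for every pair of charts; since the remaining
  components arise from those in the matching chart by Jacobians, which are smooth, only the
  diagonal pairs need to be checked.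
\<close>

lemma smooth_section_iff:
  fixes M :: "('m, 'i, 'e::euclidean_space) mfd" and N :: "('n, 'i, 'f::euclidean_space) mfd"
  assumes M: "atlas M" and N: "atlas N" and W: "mopen N W"
    and f: "\<And>u i. u \<in> pts N \<Longrightarrow> f u \<in> cdom M i \<longleftrightarrow> u \<in> cdom N i"
    and smooth_f: "\<And>i. smooth_on (chart N i ` cdom N i) (\<lambda>z. chart M i (f (cinv N i z)))"
  shows "smooth_map (open_sub N W) (tbundle M) (\<lambda>u. (f u, Y u)) \<longleftrightarrow>
    (\<forall>u\<in>W. Y u \<in> tspace M (f u)) \<and>
    (\<forall>i. smooth_on (chart N i ` (W \<inter> cdom N i)) (\<lambda>z. Y (cinv N i z) i))"
    (is "?L \<longleftrightarrow> ?T \<and> ?S")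
proof -
  have W': "W \<subseteq> pts N" "open (chart N i ` (W \<inter> cdom N i))" for i
    using W by (auto simp: mopen_def)
  have fW: "f u \<in> cdom M i \<longleftrightarrow> u \<in> cdom N i" if "u \<in> W" for u i
    using f W'(1) that by blast
  have inv: "cinv (open_sub N W) i z = cinv N i z" if "z \<in> chart N i ` (W \<inter> cdom N i)" for i z
    using cinv_open_sub[OF N that] .
  let ?F = "\<lambda>u. (f u, Y u)"
  have "?T" if ?L
    using that W'(1) unfolding smooth_map_def by (auto simp: open_sub_def tbundle_def image_subset_iff)
  moreover have "?L \<longleftrightarrow> ?S" if T: ?T
  proof -
    have pts: "?F ` pts (open_sub N W) \<subseteq> pts (tbundle M)"
    proof -
      have "f u \<in> pts M" if "u \<in> W" for u
        using atlas_pts_chart[OF N] W'(1) fW[OF that] that atlas_cdom_subset[OF M] by blast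
      then show ?thesis using T by (auto simp: open_sub_def tbundle_def)
    qed
    have dom: "chart (open_sub N W) i ` (cdom (open_sub N W) i \<inter> ?F -` cdom (tbundle M) j) =
        chart N i ` (W \<inter> cdom N i \<inter> cdom N j)" for i j
    proof -
      have "cdom (open_sub N W) i \<inter> ?F -` cdom (tbundle M) j = W \<inter> cdom N i \<inter> cdom N j"
        using T fW by (auto simp: open_sub_def tbundle_def)
      then show ?thesis by (simp add: open_sub_def)
    qed
    have opn: "open (chart N i ` (W \<inter> cdom N i \<inter> cdom N j))" for i j
    proof -
      have "mopen N (W \<inter> cdom N j)" using mopen_Int[OF N W mopen_cdom[OF N]] .
      then show ?thesis by (simp add: mopen_def Int_ac)
    qed
    let ?G = "\<lambda>i j. chart (tbundle M) j \<circ> ?F \<circ> cinv (open_sub N W) i"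
    have G: "?G i j z = (chart M j (f (cinv N i z)), Y (cinv N i z) j)"
      if "z \<in> chart N i ` (W \<inter> cdom N i)" for i j z
      using inv[OF that] by (simp add: tbundle_def)
    have L: "?L \<longleftrightarrow> (\<forall>i j. smooth_on (chart N i ` (W \<inter> cdom N i \<inter> cdom N j)) (?G i j))"
      using pts opn by (simp add: smooth_map_def dom)
    show ?thesis
    proof
      assume ?L
      show ?S
      proof
        fix i
        have "smooth_on (chart N i ` (W \<inter> cdom N i)) (?G i i)"
          using \<open>?L\<close> L[THEN iffD1, rule_format, of i i] by (simp add: Int_assoc)
        then have "smooth_on (chart N i ` (W \<inter> cdom N i)) (\<lambda>z. snd (?G i i z))"
          by (rule smooth_on_linear_image[OF W'(2) bounded_linear_snd])
        then show "smooth_on (chart N i ` (W \<inter> cdom N i)) (\<lambda>z. Y (cinv N i z) i)"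
          using smooth_on_cong[OF W'(2), of i "\<lambda>z. snd (?G i i z)" "\<lambda>z. Y (cinv N i z) i"] G
          by simp
      qed
    next
      assume S: ?S
      have "smooth_on (chart N i ` (W \<inter> cdom N i \<inter> cdom N j)) (?G i j)" for i j
      proof -
        let ?D = "chart N i ` (W \<inter> cdom N i \<inter> cdom N j)"
        let ?x = "\<lambda>z. chart M i (f (cinv N i z))"
        have zD: "cinv N i z \<in> W \<inter> cdom N i \<inter> cdom N j" if "z \<in> ?D" for z
          using that atlas_cinv_chart[OF N] by auto
        have sx: "smooth_on ?D ?x"
          using smooth_on_subset[OF smooth_f, of ?D i] by auto
        have sY: "smooth_on ?D (\<lambda>z. Y (cinv N i z) i)"
          using S smooth_on_subset[of "chart N i ` (W \<inter> cdom N i)" _ ?D] by auto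
        have xim: "?x ` ?D \<subseteq> chart M i ` (cdom M i \<inter> cdom M j)"
          using zD fW by blast
        have "smooth_on ?D (\<lambda>z. ((chart M j \<circ> cinv M i) (?x z), jac M i j (cinv M i (?x z)) (Y (cinv N i z) i)))"
          by (intro smooth_on_Pair opn smooth_on_jac_apply[where f = ?x, OF M opn xim sx sY]
            smooth_on_compose[where f = ?x and g = "chart M j \<circ> cinv M i",
              OF opn atlas_open_overlap[OF M] xim sx atlas_smooth_transition[OF M]])
        moreover have "?G i j z = ((chart M j \<circ> cinv M i) (?x z), jac M i j (cinv M i (?x z)) (Y (cinv N i z) i))"
          if z: "z \<in> ?D" for z
        proof -
          have u: "cinv N i z \<in> W" "f (cinv N i z) \<in> cdom M i" "f (cinv N i z) \<in> cdom M j"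
            using zD[OF z] fW by auto
          then have "Y (cinv N i z) j = jac M i j (f (cinv N i z)) (Y (cinv N i z) i)"
            using T tspace_jac by metis
          moreover have "z \<in> chart N i ` (W \<inter> cdom N i)" using z by auto
          ultimately show ?thesis
            using G[of z i j] u by (simp add: atlas_cinv_chart[OF M])
        qed
        ultimately show ?thesis
          using smooth_on_cong[OF opn[of i j], of "?G i j"
              "\<lambda>z. ((chart M j \<circ> cinv M i) (?x z), jac M i j (cinv M i (?x z)) (Y (cinv N i z) i))"]
          by simp
      qed
      then show ?L using L by blast
    qed
  qed
  ultimately show ?thesis by blast
qed

section \<open>The slit tangent bundle\<close>

lemma slit_cdom: "cdom (slit M) i = {u. fst u \<in> cdom M i \<and> snd u \<in> tspace M (fst u) \<and> snd u \<noteq> 0}"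
  by (auto simp: slit_def open_sub_def tbundle_def)

lemma slit_pts: "pts (slit M) = {u. fst u \<in> pts M \<and> snd u \<in> tspace M (fst u) \<and> snd u \<noteq> 0}"
  by (auto simp: slit_def open_sub_def tbundle_def)

lemma slit_chart: "chart (slit M) i u = (chart M i (fst u), snd u i)"
  by (simp add: slit_def open_sub_def tbundle_def split_beta)

text \<open>
  This names the choice of chart made in \<^const>\<open>dirderiv\<close>. The choice occurs both in the Lie bracket and
  in \<^const>\<open>rho\<close>; naming it makes visible that it is the same chart in both places.
\<close>

definition chart_at :: "('m, 'i, 'e) mfd \<Rightarrow> 'm \<Rightarrow> 'i"
  where "chart_at N p = (SOME i. p \<in> cdom N i)"

lemma dirderiv_chart_at:
  "dirderiv N f p v = frechet_derivative (f \<circ> cinv N (chart_at N p))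
     (at (chart N (chart_at N p) p)) (v (chart_at N p))"
  by (simp add: dirderiv_def chart_at_def Let_def)

lemma chart_at: "atlas N \<Longrightarrow> p \<in> pts N \<Longrightarrow> p \<in> cdom N (chart_at N p)"
  unfolding chart_at_def using atlas_pts_chart by (rule someI_ex)

lemma vector_fields_iff:
  assumes "atlas N" "mopen N W"
  shows "X \<in> vector_fields N W \<longleftrightarrow> (\<forall>p\<in>W. X p \<in> tspace N p) \<and>
    (\<forall>i. smooth_on (chart N i ` (W \<inter> cdom N i)) (\<lambda>z. X (cinv N i z) i))"
  unfolding vector_fields_def mem_Collect_eq
proof (rule smooth_section_iff[where f = "\<lambda>p. p", OF assms(1,1,2)])
  show "smooth_on (chart N i ` cdom N i) (\<lambda>z. chart N i (cinv N i z))" for i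
    using smooth_on_cong[OF atlas_open_image[OF assms(1)], of i "\<lambda>z. chart N i (cinv N i z)" "\<lambda>z. z"]
      smooth_on_bounded_linear[OF atlas_open_image[OF assms(1)] bounded_linear_ident, of i]
    by (simp add: cinv_image)
qed simp

lemma coordvec_vector_field:
  assumes N: "atlas N"
  shows "(\<lambda>p. coordvec N i p v) \<in> vector_fields N (cdom N i)"
  unfolding vector_fields_iff[OF N mopen_cdom[OF N]]
proof (intro conjI ballI allI)
  show "coordvec N i p v \<in> tspace N p" if "p \<in> cdom N i" for p
    using coordvec_in_tspace[OF N that] .
  fix j
  let ?S = "chart N j ` (cdom N i \<inter> cdom N j)" and ?f = "chart N i \<circ> cinv N j"
  have S: "?S = chart N j ` (cdom N j \<inter> cdom N i)" by (simp add: Int_commute)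
  have opn: "open ?S" unfolding S by (rule atlas_open_overlap[OF N])
  have im: "?f ` ?S \<subseteq> chart N i ` (cdom N i \<inter> cdom N j)"
    by (auto simp: atlas_cinv_chart[OF N])
  have sm: "smooth_on ?S ?f" unfolding S by (rule atlas_smooth_transition[OF N])
  have "coordvec N i (cinv N j z) v j = jac N i j (cinv N i (?f z)) v" if "z \<in> ?S" for z
    using that by (auto simp: atlas_cinv_chart[OF N] coordvec_def)
  then show "smooth_on ?S (\<lambda>z. coordvec N i (cinv N j z) v j)"
    using smooth_on_jac_apply[where f = ?f and w = "\<lambda>z. v", OF N opn im sm smooth_on_const[OF opn]]
      smooth_on_cong[OF opn, of "\<lambda>z. coordvec N i (cinv N j z) v j" "\<lambda>z. jac N i j (cinv N i (?f z)) v"]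
    by simp
qed

context
  fixes M :: "('m, 'i, 'e::euclidean_space) mfd"
  assumes M: "atlas M"
begin

lemma mem_slit_cdom_iff: "u \<in> cdom (slit M) i \<longleftrightarrow> u \<in> pts (slit M) \<and> fst u \<in> cdom M i"
  using atlas_cdom_subset[OF M] by (auto simp: slit_cdom slit_pts)

lemma slit_component_nonzero:
  assumes "u \<in> cdom (slit M) i"
  shows "snd u i \<noteq> 0"
proof
  assume 0: "snd u i = 0"
  have u: "snd u \<in> tspace M (fst u)" "fst u \<in> cdom M i" "snd u \<noteq> 0"
    using assms by (auto simp: slit_cdom)
  have "snd u = 0"
    using tspace_eqI[OF M u(1) subspace_0[OF subspace_tspace[OF M]] u(2)] 0 by simp
  with u show False by simp
qed

lemma coordvec_in_slit:
  assumes "p \<in> cdom M i" "w \<noteq> 0"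
  shows "(p, coordvec M i p w) \<in> cdom (slit M) i"
proof -
  have "coordvec M i p w i \<noteq> 0" using assms by (simp add: coordvec_self[OF M])
  then have "coordvec M i p w \<noteq> 0" by (metis zero_fun_apply)
  then show ?thesis using assms coordvec_in_tspace[OF M] by (simp add: slit_cdom)
qed

text \<open>
  In charts, the slit bundle is a product of an open set with the nonzero vectors: by linearity of
  the Jacobians, a tangent vector is nonzero iff its component in one chart is.
\<close>

lemma slit_overlap:
  "chart (slit M) i ` (cdom (slit M) i \<inter> cdom (slit M) j) =
   chart M i ` (cdom M i \<inter> cdom M j) \<times> (- {0})" (is "?L = ?R")
proof (intro equalityI subsetI)
  fix z assume "z \<in> ?L"
  then show "z \<in> ?R"
    using slit_component_nonzero by (auto simp: slit_chart mem_slit_cdom_iff)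
next
  fix z assume "z \<in> ?R"
  then obtain p w where p: "p \<in> cdom M i" "p \<in> cdom M j" "w \<noteq> 0" "z = (chart M i p, w)" by auto
  let ?u = "(p, coordvec M i p w)"
  have u: "?u \<in> cdom (slit M) i" using coordvec_in_slit p by blast
  then have "?u \<in> cdom (slit M) i \<inter> cdom (slit M) j" using p by (simp add: mem_slit_cdom_iff)
  moreover have "z = chart (slit M) i ?u"
    using p by (simp add: slit_chart coordvec_self[OF M])
  ultimately show "z \<in> ?L" by blast
qed

lemma inj_on_slit_chart: "inj_on (chart (slit M) i) (cdom (slit M) i)"
proof (rule inj_onI)
  fix u w
  assume u: "u \<in> cdom (slit M) i" and w: "w \<in> cdom (slit M) i"
    and eq: "chart (slit M) i u = chart (slit M) i w"
  have 1: "fst u = fst w"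
    using u w eq atlas_chart_eq_iff[OF M] by (auto simp: slit_chart slit_cdom)
  moreover have "snd u = snd w"
    by (rule tspace_eqI[OF M, of _ "fst u" _ i]) (use u w eq 1 in \<open>auto simp: slit_chart slit_cdom\<close>)
  ultimately show "u = w" by (rule prod_eqI)
qed

lemma cinv_slit:
  assumes "p \<in> cdom M i" "w \<noteq> 0"
  shows "cinv (slit M) i (chart M i p, w) = (p, coordvec M i p w)"
  unfolding cinv_def
  by (rule inv_into_f_eq[OF inj_on_slit_chart coordvec_in_slit[OF assms]])
    (simp add: slit_chart coordvec_self[OF M assms(1)])

lemma slit_transition:
  assumes "p \<in> cdom M i" "w \<noteq> 0" "p \<in> cdom M j"
  shows "(chart (slit M) j \<circ> cinv (slit M) i) (chart M i p, w) = (chart M j p, jac M i j p w)"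
  using assms by (simp add: cinv_slit slit_chart coordvec_def)

lemma atlas_slit: "atlas (slit M)"
  unfolding atlas_def
proof (intro conjI allI)
  show "pts (slit M) = (\<Union>i. cdom (slit M) i)"
    using M by (auto simp: slit_cdom slit_pts atlas_def)
  show "inj_on (chart (slit M) i) (cdom (slit M) i)" for i
    by (rule inj_on_slit_chart)
  fix i j
  let ?S = "chart M i ` (cdom M i \<inter> cdom M j) \<times> (- {0::'e})"
  have opn: "open ?S" using atlas_open_overlap[OF M] by (intro open_Times) auto
  then show "open (chart (slit M) i ` (cdom (slit M) i \<inter> cdom (slit M) j))"
    by (simp add: slit_overlap)
  have im: "fst ` ?S \<subseteq> chart M i ` (cdom M i \<inter> cdom M j)" by auto
  have lin: "smooth_on ?S fst" "smooth_on ?S snd"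
    by (auto intro!: smooth_on_bounded_linear opn bounded_linear_fst bounded_linear_snd)
  have "smooth_on ?S (\<lambda>z. ((chart M j \<circ> cinv M i) (fst z), jac M i j (cinv M i (fst z)) (snd z)))"
    by (intro smooth_on_Pair opn smooth_on_jac_apply[where f = fst, OF M opn im lin]
      smooth_on_compose[where f = fst and g = "chart M j \<circ> cinv M i",
        OF opn atlas_open_overlap[OF M] im lin(1) atlas_smooth_transition[OF M]])
  moreover have "(chart (slit M) j \<circ> cinv (slit M) i) z =
      ((chart M j \<circ> cinv M i) (fst z), jac M i j (cinv M i (fst z)) (snd z))" if z: "z \<in> ?S" for z
  proof -
    obtain p w where p: "p \<in> cdom M i" "p \<in> cdom M j" "w \<noteq> 0" "z = (chart M i p, w)"
      using z by auto
    then show ?thesis using slit_transition[OF p(1,3,2)] by (simp add: atlas_cinv_chart[OF M])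
  qed
  ultimately show "smooth_on (chart (slit M) i ` (cdom (slit M) i \<inter> cdom (slit M) j))
      (chart (slit M) j \<circ> cinv (slit M) i)"
    unfolding slit_overlap using smooth_on_cong[OF opn, of "chart (slit M) j \<circ> cinv (slit M) i"
      "\<lambda>z. ((chart M j \<circ> cinv M i) (fst z), jac M i j (cinv M i (fst z)) (snd z))"] by simp
qed

text \<open>
  In charts of the slit bundle the projection to \<open>M\<close> is \<^const>\<open>fst\<close> followed by a change of coordinates.
\<close>

lemma slit_projection_has_derivative:
  assumes "u \<in> cdom (slit M) i" "fst u \<in> cdom M j"
  shows "((\<lambda>z. chart M j (fst (cinv (slit M) i z))) has_derivative
    (\<lambda>\<xi>. jac M i j (fst u) (fst \<xi>))) (at (chart (slit M) i u))"
proof -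
  let ?S = "chart (slit M) i ` (cdom (slit M) i \<inter> cdom (slit M) j)"
  have u: "u \<in> cdom (slit M) j" "fst u \<in> cdom M i" using assms by (auto simp: mem_slit_cdom_iff)
  have "(fst has_derivative fst) (at (chart (slit M) i u))"
    by (rule bounded_linear_imp_has_derivative[OF bounded_linear_fst])
  moreover have "((chart M j \<circ> cinv M i) has_derivative jac M i j (fst u))
      (at (fst (chart (slit M) i u)))"
    using jac_has_derivative[OF M u(2) assms(2)] by (simp add: slit_chart)
  ultimately have "((\<lambda>z. (chart M j \<circ> cinv M i) (fst z)) has_derivative
      (\<lambda>\<xi>. jac M i j (fst u) (fst \<xi>))) (at (chart (slit M) i u))"
    by (rule has_derivative_compose)
  then show ?thesis
  proof (rule has_derivative_transform_within_open[OF _ atlas_open_overlap[OF atlas_slit, of i j]])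
    show "chart (slit M) i u \<in> ?S" using assms u by blast
    show "(chart M j \<circ> cinv M i) (fst z) = chart M j (fst (cinv (slit M) i z))" if z: "z \<in> ?S" for z
    proof -
      obtain p w where "p \<in> cdom M i" "w \<noteq> 0" "z = (chart M i p, w)"
        using z unfolding slit_overlap by auto
      then show ?thesis by (simp add: cinv_slit atlas_cinv_chart[OF M])
    qed
  qed
qed

lemma fst_jac_slit:
  assumes "u \<in> cdom (slit M) i" "u \<in> cdom (slit M) j"
  shows "fst (jac (slit M) i j u \<xi>) = jac M i j (fst u) (fst \<xi>)"
proof -
  have j: "fst u \<in> cdom M j" using assms(2) by (simp add: mem_slit_cdom_iff)
  have "((\<lambda>z. fst ((chart (slit M) j \<circ> cinv (slit M) i) z)) has_derivative
      (\<lambda>\<xi>. fst (jac (slit M) i j u \<xi>))) (at (chart (slit M) i u))"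
    by (rule has_derivative_fst[OF jac_has_derivative[OF atlas_slit assms]])
  then have "((\<lambda>z. chart M j (fst (cinv (slit M) i z))) has_derivative
      (\<lambda>\<xi>. fst (jac (slit M) i j u \<xi>))) (at (chart (slit M) i u))"
    by (simp add: slit_chart)
  from has_derivative_unique[OF this slit_projection_has_derivative[OF assms(1) j]]
  show ?thesis by (rule fun_cong)
qed

text \<open>
  On the fibre over a point the change of coordinates of the slit bundle is linear, namely the
  Jacobian of \<open>M\<close>, so it is its own derivative in fibre directions.
\<close>

lemma jac_slit_vertical:
  assumes "u \<in> cdom (slit M) i" "u \<in> cdom (slit M) j"
  shows "jac (slit M) i j u (0, v) = (0, jac M i j (fst u) v)"
  unfolding jac_def[of "slit M"]
proof (rule frechet_derivative_along_line)
  let ?g = "chart (slit M) j \<circ> cinv (slit M) i" and ?y = "snd u i"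
  have p: "fst u \<in> cdom M i" "fst u \<in> cdom M j" using assms by (simp_all add: mem_slit_cdom_iff)
  show "?g differentiable at (chart (slit M) i u)"
    using jac_has_derivative[OF atlas_slit assms] by (auto simp: differentiable_def)
  let ?T = "{t. ?y + t *\<^sub>R v \<noteq> 0}"
  have T: "open ?T" by (intro open_Collect_neq continuous_intros)
  have "((\<lambda>t. (chart M j (fst u), jac M i j (fst u) ?y + t *\<^sub>R jac M i j (fst u) v))
      has_vector_derivative (0, jac M i j (fst u) v)) (at 0)"
    by (intro has_vector_derivative_Pair) (auto intro!: derivative_eq_intros)
  then show "((\<lambda>t. ?g (chart (slit M) i u + t *\<^sub>R (0, v)))
      has_vector_derivative (0, jac M i j (fst u) v)) (at 0)"
  proof (rule has_vector_derivative_transform_within_open[OF _ T])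
    show "0 \<in> ?T" using slit_component_nonzero[OF assms(1)] by simp
    show "(chart M j (fst u), jac M i j (fst u) ?y + t *\<^sub>R jac M i j (fst u) v) =
        ?g (chart (slit M) i u + t *\<^sub>R (0, v))" if "t \<in> ?T" for t
    proof -
      have "chart (slit M) i u + t *\<^sub>R (0, v) = (chart M i (fst u), ?y + t *\<^sub>R v)"
        by (simp add: slit_chart)
      then have "?g (chart (slit M) i u + t *\<^sub>R (0, v))
          = (chart M j (fst u), jac M i j (fst u) (?y + t *\<^sub>R v))"
        using slit_transition[OF p(1) _ p(2), of "?y + t *\<^sub>R v"] that by (metis mem_Collect_eq)
      then show ?thesis
        using linear_jac[OF M p] by (simp add: linear_add linear_scale)
    qed
  qed
qed

section \<open>Vertical lift and projection\<close>

lemma vlift_eq: "vlift M u v = (\<lambda>i. if u \<in> cdom (slit M) i then (0, v i) else 0)"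
proof -
  have "((\<lambda>t. (chart M i (fst u), snd u i + t *\<^sub>R v i)) has_vector_derivative (0, v i)) (at 0)" for i
    by (intro has_vector_derivative_Pair) (auto intro!: derivative_eq_intros)
  from vector_derivative_at[OF this] show ?thesis
    by (simp add: vlift_def slit_chart scaleR_fun_def fun_eq_iff)
qed

lemma vlift_in_tspace:
  assumes "v \<in> tspace M (fst u)"
  shows "vlift M u v \<in> tspace (slit M) u"
proof (rule tspaceI)
  show "vlift M u v j = jac (slit M) i j u (vlift M u v i)"
    if ij: "u \<in> cdom (slit M) i" "u \<in> cdom (slit M) j" for i j
  proof -
    have "v j = jac M i j (fst u) (v i)"
      by (rule tspace_jac[OF assms]) (use ij in \<open>auto simp: mem_slit_cdom_iff\<close>)
    then show ?thesis using ij by (simp add: vlift_eq jac_slit_vertical)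
  qed
qed (simp add: vlift_eq)

text \<open>
  The formula holds for an arbitrary family \<open>\<xi>\<close>, tangent or not. Hence \<^const>\<open>rho\<close> can be applied to a Lie
  bracket without proving that the bracket is a tangent vector, which would require the symmetry of
  second derivatives.
\<close>

lemma rho_chart_at:
  assumes "u \<in> pts (slit M)"
  shows "rho M u \<xi> = coordvec M (chart_at (slit M) u) (fst u) (fst (\<xi> (chart_at (slit M) u)))"
proof
  fix j
  let ?i = "chart_at (slit M) u"
  have i: "u \<in> cdom (slit M) ?i" using chart_at[OF atlas_slit assms] .
  show "rho M u \<xi> j = coordvec M ?i (fst u) (fst (\<xi> ?i)) j"
  proof (cases "fst u \<in> cdom M j")
    case True
    have "frechet_derivative (\<lambda>z. chart M j (fst (cinv (slit M) ?i z))) (at (chart (slit M) ?i u)) (\<xi> ?i)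
        = jac M ?i j (fst u) (fst (\<xi> ?i))"
      by (rule fun_cong[OF frechet_derivative_at[OF slit_projection_has_derivative[OF i True], symmetric]])
    then show ?thesis
      using True by (simp add: rho_def differential_def dirderiv_chart_at coordvec_def comp_def)
  qed (simp add: rho_def differential_def coordvec_def)
qed

lemma linear_rho: "u \<in> pts (slit M) \<Longrightarrow> linear (rho M u)"
proof (rule linearI)
  assume u: "u \<in> pts (slit M)"
  have lin: "linear (coordvec M (chart_at (slit M) u) (fst u))"
    using linear_coordvec[OF M] chart_at[OF atlas_slit u] by (simp add: mem_slit_cdom_iff)
  show "rho M u (\<xi> + \<zeta>) = rho M u \<xi> + rho M u \<zeta>" for \<xi> \<zeta>
    using u by (simp add: rho_chart_at linear_add[OF lin])
  show "rho M u (r *\<^sub>R \<xi>) = r *\<^sub>R rho M u \<xi>" for r \<xi>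
    using u by (simp add: rho_chart_at linear_scale[OF lin] scaleR_fun_def[of r \<xi>])
qed

lemma rho_tangent:
  assumes u: "u \<in> pts (slit M)" and \<xi>: "\<xi> \<in> tspace (slit M) u"
  shows "rho M u \<xi> = (\<lambda>j. fst (\<xi> j))"
proof
  fix j
  let ?i = "chart_at (slit M) u"
  have i: "u \<in> cdom (slit M) ?i" using chart_at[OF atlas_slit u] .
  show "rho M u \<xi> j = fst (\<xi> j)"
  proof (cases "u \<in> cdom (slit M) j")
    case True
    have "\<xi> j = jac (slit M) ?i j u (\<xi> ?i)" using tspace_jac[OF \<xi> i True] .
    then have "fst (\<xi> j) = jac M ?i j (fst u) (fst (\<xi> ?i))" by (simp only: fst_jac_slit[OF i True])
    then show ?thesis
      using True u by (simp add: rho_chart_at coordvec_def mem_slit_cdom_iff)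
  next
    case False
    then show ?thesis
      using u tspace_zero[OF \<xi> False] by (simp add: rho_chart_at coordvec_def mem_slit_cdom_iff)
  qed
qed

lemma rho_in_tspace: "u \<in> pts (slit M) \<Longrightarrow> rho M u \<xi> \<in> tspace M (fst u)"
  using coordvec_in_tspace[OF M] chart_at[OF atlas_slit] by (simp add: rho_chart_at mem_slit_cdom_iff)

lemma rho_vlift: "u \<in> pts (slit M) \<Longrightarrow> rho M u (vlift M u v) = 0"
proof -
  assume u: "u \<in> pts (slit M)"
  have "fst u \<in> cdom M (chart_at (slit M) u)"
    using chart_at[OF atlas_slit u] by (simp add: mem_slit_cdom_iff)
  from linear_0[OF linear_coordvec[OF M this]] show ?thesis
    using u by (simp add: rho_chart_at vlift_eq)
qed

section \<open>Fields along the projection\<close>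

lemma pifields_on_iff:
  assumes "mopen (slit M) W"
  shows "Y \<in> pifields_on M W \<longleftrightarrow> (\<forall>u\<in>W. Y u \<in> tspace M (fst u)) \<and>
    (\<forall>i. smooth_on (chart (slit M) i ` (W \<inter> cdom (slit M) i)) (\<lambda>z. Y (cinv (slit M) i z) i))"
  unfolding pifields_on_def mem_Collect_eq
proof (rule smooth_section_iff[where f = fst, OF M atlas_slit assms])
  show "fst u \<in> cdom M i \<longleftrightarrow> u \<in> cdom (slit M) i" if "u \<in> pts (slit M)" for u i
    using that by (simp add: mem_slit_cdom_iff)
  show "smooth_on (chart (slit M) i ` cdom (slit M) i) (\<lambda>z. chart M i (fst (cinv (slit M) i z)))" for i
  proof -
    let ?S = "chart (slit M) i ` cdom (slit M) i"
    have opn: "open ?S" using atlas_open_image[OF atlas_slit] .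
    have "chart M i (fst (cinv (slit M) i z)) = fst z" if "z \<in> ?S" for z
      using cinv_image(2)[OF that] slit_chart[of M i "cinv (slit M) i z"] by (metis fst_conv)
    then show ?thesis
      using smooth_on_cong[OF opn, of "\<lambda>z. chart M i (fst (cinv (slit M) i z))" fst]
        smooth_on_bounded_linear[OF opn bounded_linear_fst] by simp
  qed
qed

lemma pifields_iff:
  "Y \<in> pifields M \<longleftrightarrow> (\<forall>u\<in>pts (slit M). Y u \<in> tspace M (fst u)) \<and>
    (\<forall>i. smooth_on (chart (slit M) i ` cdom (slit M) i) (\<lambda>z. Y (cinv (slit M) i z) i))"
  using pifields_on_iff[OF mopen_pts[OF atlas_slit]] atlas_cdom_subset[OF atlas_slit]
  by (simp add: pifields_def Int_absorb1)

lemma pifields_subset: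
  assumes "mopen (slit M) W" "Y \<in> pifields M"
  shows "Y \<in> pifields_on M W"
  unfolding pifields_on_iff[OF assms(1)]
proof (intro conjI ballI allI)
  show "Y u \<in> tspace M (fst u)" if "u \<in> W" for u
    using that assms by (auto simp: mopen_def pifields_iff)
  show "smooth_on (chart (slit M) i ` (W \<inter> cdom (slit M) i)) (\<lambda>z. Y (cinv (slit M) i z) i)" for i
    by (rule smooth_on_subset[of "chart (slit M) i ` cdom (slit M) i"])
      (use assms(2) in \<open>auto simp: pifields_iff\<close>)
qed

lemma pifields_on_cong:
  assumes W: "mopen (slit M) W" and eq: "\<And>u. u \<in> W \<Longrightarrow> Y u = Z u"
  shows "Y \<in> pifields_on M W \<longleftrightarrow> Z \<in> pifields_on M W"
proof -
  have "open (chart (slit M) i ` (W \<inter> cdom (slit M) i))" for i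
    using W by (simp add: mopen_def)
  then have "smooth_on (chart (slit M) i ` (W \<inter> cdom (slit M) i)) (\<lambda>z. Y (cinv (slit M) i z) i) \<longleftrightarrow>
      smooth_on (chart (slit M) i ` (W \<inter> cdom (slit M) i)) (\<lambda>z. Z (cinv (slit M) i z) i)" for i
    by (rule smooth_on_cong) (auto simp: atlas_cinv_chart[OF atlas_slit] eq)
  then show ?thesis
    unfolding pifields_on_iff[OF W] by (simp add: eq)
qed

lemma pifields_cong:
  "(\<And>u. u \<in> pts (slit M) \<Longrightarrow> Y u = Z u) \<Longrightarrow> Y \<in> pifields M \<longleftrightarrow> Z \<in> pifields M"
  unfolding pifields_def by (rule pifields_on_cong[OF mopen_pts[OF atlas_slit]])

lemma pifields_linear_combination:
  assumes "Y \<in> pifields M" "Z \<in> pifields M"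
  shows "(\<lambda>u. a *\<^sub>R Y u + b *\<^sub>R Z u) \<in> pifields M"
  unfolding pifields_iff
proof (intro conjI ballI allI)
  show "a *\<^sub>R Y u + b *\<^sub>R Z u \<in> tspace M (fst u)" if "u \<in> pts (slit M)" for u
    using assms that subspace_tspace[OF M] by (auto simp: pifields_iff intro!: subspace_add subspace_scale)
  show "smooth_on (chart (slit M) i ` cdom (slit M) i)
      (\<lambda>z. (a *\<^sub>R Y (cinv (slit M) i z) + b *\<^sub>R Z (cinv (slit M) i z)) i)" for i
    unfolding plus_fun_apply scaleR_fun_def
    by (intro smooth_on_add atlas_open_image[OF atlas_slit]
      smooth_on_linear_image[where h = "\<lambda>v. r *\<^sub>R v" for r, OF _ bounded_linear_scaleR_right])
      (use assms in \<open>auto simp: pifields_iff\<close>)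
qed

lemma fundamental_in_pifields: "fundamental \<in> pifields M"
  unfolding pifields_iff
proof (intro conjI ballI allI)
  show "fundamental u \<in> tspace M (fst u)" if "u \<in> pts (slit M)" for u
    using that by (simp add: fundamental_def slit_pts)
  fix i
  let ?S = "chart (slit M) i ` cdom (slit M) i"
  have opn: "open ?S" using atlas_open_image[OF atlas_slit] .
  have "fundamental (cinv (slit M) i z) i = snd z" if "z \<in> ?S" for z
    using cinv_image(2)[OF that] slit_chart[of M i "cinv (slit M) i z"]
    unfolding fundamental_def by (metis snd_conv)
  then show "smooth_on ?S (\<lambda>z. fundamental (cinv (slit M) i z) i)"
    using smooth_on_cong[OF opn, of "\<lambda>z. fundamental (cinv (slit M) i z) i" snd]
      smooth_on_bounded_linear[OF opn bounded_linear_snd] by simp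
qed

lemma vfield_vector_field:
  assumes "X \<in> pifields M"
  shows "vfield M X \<in> vector_fields (slit M) (pts (slit M))"
  unfolding vector_fields_iff[OF atlas_slit mopen_pts[OF atlas_slit]]
proof (intro conjI ballI allI)
  show "vfield M X u \<in> tspace (slit M) u" if "u \<in> pts (slit M)" for u
    using assms that by (simp add: vfield_def vlift_in_tspace pifields_iff)
  fix i
  let ?S = "chart (slit M) i ` cdom (slit M) i"
  have S: "pts (slit M) \<inter> cdom (slit M) i = cdom (slit M) i"
    using atlas_cdom_subset[OF atlas_slit] by (rule Int_absorb1)
  have opn: "open ?S" using atlas_open_image[OF atlas_slit] .
  have "smooth_on ?S (\<lambda>z. (0, X (cinv (slit M) i z) i))"
    by (intro smooth_on_Pair smooth_on_const opn) (use assms in \<open>simp add: pifields_iff\<close>)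
  moreover have "vfield M X (cinv (slit M) i z) i = (0, X (cinv (slit M) i z) i)" if "z \<in> ?S" for z
    using cinv_image(1)[OF that] by (simp add: vfield_def vlift_eq)
  ultimately show "smooth_on (chart (slit M) i ` (pts (slit M) \<inter> cdom (slit M) i))
      (\<lambda>z. vfield M X (cinv (slit M) i z) i)"
    unfolding S using smooth_on_cong[OF opn, of "\<lambda>z. vfield M X (cinv (slit M) i z) i"
      "\<lambda>z. (0, X (cinv (slit M) i z) i)"] by simp
qed

end

section \<open>Connections are local\<close>

context
  fixes M :: "('m, 'i, 'e::euclidean_space) mfd"
  assumes M: "atlas M"
begin

lemma slit_mopen_pts: "mopen (slit M) (pts (slit M))"
  by (rule mopen_pts[OF atlas_slit[OF M]])

lemma connection_linear:
  assumes "is_connection M D" "mopen (slit M) W" "u \<in> W" "Y \<in> pifields_on M W"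
    and "\<xi> \<in> tspace (slit M) u" "\<zeta> \<in> tspace (slit M) u"
  shows "D u (a *\<^sub>R \<xi> + b *\<^sub>R \<zeta>) Y = a *\<^sub>R D u \<xi> Y + b *\<^sub>R D u \<zeta> Y"
  using assms unfolding is_connection_def by blast

lemma connection_smooth:
  assumes "is_connection M D" "mopen (slit M) W"
    and "X \<in> vector_fields (slit M) W" "Y \<in> pifields_on M W"
  shows "(\<lambda>u. D u (X u) Y) \<in> pifields_on M W"
  using assms by (simp add: is_connection_def)

text \<open>
  The indicator function of an open set \<open>W\<close> is smooth on \<open>W\<close>, where it equals \<open>1\<close> and has derivative
  \<open>0\<close>. By the Leibniz rule, multiplying a section by it does not change the covariant derivative in
  \<open>W\<close>, while it erases the values outside \<open>W\<close>.
\<close>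

lemma connection_local:
  assumes D: "is_connection M D" and W: "mopen (slit M) W" and u: "u \<in> W"
    and \<xi>: "\<xi> \<in> tspace (slit M) u" and Y: "Y \<in> pifields_on M W"
    and eq: "\<And>w. w \<in> W \<Longrightarrow> Y w = Z w"
  shows "D u \<xi> Y = D u \<xi> Z"
proof -
  \<comment> \<open>multiplying by \<open>f\<close> replaces a section by \<open>0\<close> outside \<open>W\<close>\<close>
  define f :: "'m \<times> ('i \<Rightarrow> 'e) \<Rightarrow> real" where "f = (\<lambda>w. if w \<in> W then 1 else 0)"
  have opn: "open (chart (slit M) i ` (W \<inter> cdom (slit M) i))" for i
    using W by (simp add: mopen_def)
  have one: "f (cinv (slit M) i z) = 1" if "z \<in> chart (slit M) i ` (W \<inter> cdom (slit M) i)" for i z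
    using that by (auto simp: f_def atlas_cinv_chart[OF atlas_slit[OF M]])
  have smooth: "smooth_fun (open_sub (slit M) W) f"
    unfolding smooth_fun_def
  proof
    fix i
    let ?S = "chart (slit M) i ` (W \<inter> cdom (slit M) i)"
    have "(f \<circ> cinv (open_sub (slit M) W) i) z = 1" if "z \<in> ?S" for z
      using one[OF that] by (simp add: cinv_open_sub[OF atlas_slit[OF M] that])
    then have "smooth_on ?S (f \<circ> cinv (open_sub (slit M) W) i)"
      using smooth_on_cong[OF opn, of i "f \<circ> cinv (open_sub (slit M) W) i" "\<lambda>z. 1"]
        smooth_on_const[OF opn] by simp
    then show "smooth_on (chart (open_sub (slit M) W) i ` cdom (open_sub (slit M) W) i)
        (f \<circ> cinv (open_sub (slit M) W) i)"
      by (simp add: open_sub_def Int_commute)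
  qed
  have flat: "dirderiv (slit M) f u \<xi> = 0"
  proof -
    let ?i = "chart_at (slit M) u"
    have "u \<in> cdom (slit M) ?i"
      using chart_at[OF atlas_slit[OF M], of u] u W by (auto simp: mopen_def)
    then have "frechet_derivative (f \<circ> cinv (slit M) ?i) (at (chart (slit M) ?i u)) =
        frechet_derivative (\<lambda>z. 1) (at (chart (slit M) ?i u))"
      using u one by (intro frechet_derivative_cong_open[OF opn[of ?i]]) auto
    then show ?thesis by (simp add: dirderiv_chart_at)
  qed
  have cut: "D u \<xi> (\<lambda>w. f w *\<^sub>R V w) = D u \<xi> V" if "V \<in> pifields_on M W" for V
  proof -
    have "D u \<xi> (\<lambda>w. f w *\<^sub>R V w) = dirderiv (slit M) f u \<xi> *\<^sub>R V u + f u *\<^sub>R D u \<xi> V"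
      using D W u that \<xi> smooth unfolding is_connection_def by blast
    also have "\<dots> = D u \<xi> V" unfolding flat using u by (simp add: f_def)
    finally show ?thesis .
  qed
  have Z: "Z \<in> pifields_on M W" using Y pifields_on_cong[OF M W eq] by simp
  have "(\<lambda>w. f w *\<^sub>R Y w) = (\<lambda>w. f w *\<^sub>R Z w)" using eq by (auto simp: f_def)
  then show ?thesis using cut[OF Y] cut[OF Z] by simp
qed

lemma connection_cong:
  assumes "is_connection M D" "u \<in> pts (slit M)" "\<xi> \<in> tspace (slit M) u" "Y \<in> pifields M"
    and "\<And>w. w \<in> pts (slit M) \<Longrightarrow> Y w = Z w"
  shows "D u \<xi> Y = D u \<xi> Z"
  using connection_local[OF assms(1) slit_mopen_pts assms(2,3)] assms(4,5)
  unfolding pifields_def by blast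

lemma connection_add:
  assumes "is_connection M D" "u \<in> pts (slit M)" "\<xi> \<in> tspace (slit M) u"
    and "Y \<in> pifields M" "Z \<in> pifields M"
  shows "D u \<xi> (\<lambda>w. Y w + Z w) = D u \<xi> Y + D u \<xi> Z"
  using assms slit_mopen_pts unfolding is_connection_def pifields_def by blast

lemma connection_zero:
  assumes D: "is_connection M D" and u: "u \<in> pts (slit M)" and \<xi>: "\<xi> \<in> tspace (slit M) u"
    and zero: "\<And>w. w \<in> pts (slit M) \<Longrightarrow> Y w = 0"
  shows "D u \<xi> Y = 0"
proof -
  have "(\<lambda>w. 0 *\<^sub>R fundamental w + 0 *\<^sub>R fundamental w) \<in> pifields M"
    using pifields_linear_combination[OF M fundamental_in_pifields[OF M] fundamental_in_pifields[OF M]] .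
  then have Y: "Y \<in> pifields M"
    by (subst pifields_cong[OF M, of Y "\<lambda>w. 0 *\<^sub>R fundamental w + 0 *\<^sub>R fundamental w"])
      (simp_all add: zero)
  \<comment> \<open>\<open>Y + Y\<close> and \<open>Y\<close> agree where \<open>Y\<close> vanishes, so locality and additivity give \<open>x + x = x\<close>\<close>
  have "D u \<xi> (\<lambda>w. Y w + Y w) = D u \<xi> Y"
    using pifields_linear_combination[OF M Y Y, of 1 1] zero
    by (intro connection_cong[OF D u \<xi>]) simp_all
  then show ?thesis using connection_add[OF D u \<xi> Y Y] by simp
qed

lemma cov_in_pifields:
  assumes "is_connection M D" "X \<in> vector_fields (slit M) (pts (slit M))" "Y \<in> pifields M"
  shows "cov D X Y \<in> pifields M"
  using connection_smooth[OF assms(1) slit_mopen_pts] assms(2,3) by (simp add: cov_def pifields_def)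

section \<open>The horizontal lift of a regular connection\<close>

lemma connection_map_linear:
  assumes "is_connection M D" "u \<in> pts (slit M)" "\<xi> \<in> tspace (slit M) u" "\<zeta> \<in> tspace (slit M) u"
  shows "connection_map D u (a *\<^sub>R \<xi> + b *\<^sub>R \<zeta>) = a *\<^sub>R connection_map D u \<xi> + b *\<^sub>R connection_map D u \<zeta>"
  unfolding connection_map_def
  by (rule connection_linear[OF assms(1) slit_mopen_pts assms(2) _ assms(3,4)])
    (use fundamental_in_pifields[OF M] in \<open>simp add: pifields_def\<close>)

lemma regular_Int: "regular M D \<Longrightarrow> u \<in> pts (slit M) \<Longrightarrow> vspace M u \<inter> hspace M D u = {0}"
  by (simp add: regular_def)

lemma rho_inj_on_hspace:
  assumes D: "is_connection M D" "regular M D" and u: "u \<in> pts (slit M)"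
    and \<xi>: "\<xi> \<in> hspace M D u" and \<zeta>: "\<zeta> \<in> hspace M D u" and eq: "rho M u \<xi> = rho M u \<zeta>"
  shows "\<xi> = \<zeta>"
proof -
  have T: "\<xi> \<in> tspace (slit M) u" "\<zeta> \<in> tspace (slit M) u"
    and K: "connection_map D u \<xi> = 0" "connection_map D u \<zeta> = 0"
    using \<xi> \<zeta> by (auto simp: hspace_def)
  have "\<xi> - \<zeta> \<in> tspace (slit M) u"
    using T by (rule subspace_diff[OF subspace_tspace[OF atlas_slit[OF M]]])
  moreover have "connection_map D u (\<xi> - \<zeta>) = 0"
    using connection_map_linear[OF D(1) u T, of 1 "-1"] K by simp
  moreover have "rho M u (\<xi> - \<zeta>) = 0"
    using eq by (simp add: linear_diff[OF linear_rho[OF M u]])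
  ultimately have "\<xi> - \<zeta> \<in> vspace M u \<inter> hspace M D u" by (simp add: vspace_def hspace_def)
  then have "\<xi> - \<zeta> = 0" using regular_Int[OF D(2) u] by auto
  then show ?thesis by simp
qed

lemma hlift:
  assumes D: "is_connection M D" "regular M D" and u: "u \<in> pts (slit M)" and v: "v \<in> tspace M (fst u)"
  shows hlift_in_hspace: "hlift M D u v \<in> hspace M D u" and rho_hlift: "rho M u (hlift M D u v) = v"
proof -
  obtain i where i: "u \<in> cdom (slit M) i" using atlas_pts_chart[OF atlas_slit[OF M] u] by blast
  \<comment> \<open>any preimage under \<open>\<rho>\<close> will do; its horizontal part is the lift\<close>
  let ?\<xi> = "coordvec (slit M) i u (v i, 0)"
  have \<xi>: "?\<xi> \<in> tspace (slit M) u" using coordvec_in_tspace[OF atlas_slit[OF M] i] .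
  have p: "fst u \<in> cdom M i" using i mem_slit_cdom_iff[OF M] by blast
  have "rho M u ?\<xi> i = v i"
    using rho_tangent[OF M u \<xi>] by (simp add: coordvec_self[OF atlas_slit[OF M] i])
  then have rho: "rho M u ?\<xi> = v"
    by (intro tspace_eqI[OF M rho_in_tspace[OF M u] v p])
  have "tspace (slit M) u = {\<zeta> + \<eta> | \<zeta> \<eta>. \<zeta> \<in> vspace M u \<and> \<eta> \<in> hspace M D u}"
    using D(2) u by (simp add: regular_def)
  then obtain \<zeta> \<eta> where *: "?\<xi> = \<zeta> + \<eta>" "\<zeta> \<in> vspace M u" "\<eta> \<in> hspace M D u"
    using \<xi> by auto
  have "rho M u \<eta> = v"
    using rho * linear_add[OF linear_rho[OF M u], of \<zeta> \<eta>] by (simp add: vspace_def)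
  then have v': "v \<in> rho M u ` hspace M D u" using *(3) by blast
  show "hlift M D u v \<in> hspace M D u" unfolding hlift_def by (rule inv_into_into[OF v'])
  show "rho M u (hlift M D u v) = v" unfolding hlift_def by (rule f_inv_into_f[OF v'])
qed

lemma hlift_eqI:
  assumes "is_connection M D" "regular M D" "u \<in> pts (slit M)"
    and "\<xi> \<in> hspace M D u" "rho M u \<xi> = v"
  shows "hlift M D u v = \<xi>"
proof -
  have v: "v \<in> tspace M (fst u)" using assms(5) rho_in_tspace[OF M assms(3)] by blast
  show ?thesis
    by (rule rho_inj_on_hspace[OF assms(1-3) hlift_in_hspace[OF assms(1-3) v] assms(4)])
      (simp add: rho_hlift[OF assms(1-3) v] assms(5))
qed

text \<open>
  In a chart \<open>i\<close>, a tangent vector \<open>\<xi>\<close> of the slit bundle is a pair, and the component of the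
  horizontal lift of \<open>X\<close> solves the linear system \<open>fst \<xi> = X i\<close>, \<open>K \<xi> = 0\<close>, where \<open>K\<close> is the connection
  map. Its coefficients are smooth because \<open>K\<close> is applied to coordinate fields, and it is
  nondegenerate since vertical and horizontal space meet in \<open>0\<close>. So smoothness of the lift follows
  from that of solutions of linear systems.
\<close>

lemma hfield_vector_field:
  assumes D: "is_connection M D" "regular M D" and X: "X \<in> pifields M"
  shows "hfield M D X \<in> vector_fields (slit M) (pts (slit M))"
  unfolding vector_fields_iff[OF atlas_slit[OF M] slit_mopen_pts]
proof (intro conjI ballI allI)
  have lift: "hlift M D u (X u) \<in> hspace M D u" "rho M u (hlift M D u (X u)) = X u"
    if "u \<in> pts (slit M)" for u
    using hlift[OF D that] X that by (auto simp: pifields_iff[OF M])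
  then show "hfield M D X u \<in> tspace (slit M) u" if "u \<in> pts (slit M)" for u
    using that by (simp add: hfield_def hspace_def)
  fix i
  let ?W = "cdom (slit M) i" and ?S = "chart (slit M) i ` cdom (slit M) i"
  let ?c = "cinv (slit M) i"
  \<comment> \<open>the pair of \<open>\<rho>\<close> and the connection map at the point with coordinates \<open>z\<close>, in chart \<open>i\<close>\<close>
  define A where "A z \<xi> = (fst \<xi>, connection_map D (?c z) (coordvec (slit M) i (?c z) \<xi>) i)" for z \<xi>
  have opn: "open ?S" using atlas_open_image[OF atlas_slit[OF M]] .
  have W: "mopen (slit M) ?W" using mopen_cdom[OF atlas_slit[OF M]] .
  have \<eta>: "fundamental \<in> pifields_on M ?W"
    using pifields_subset[OF M W fundamental_in_pifields[OF M]] .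
  have K: "(\<lambda>u. connection_map D u (coordvec (slit M) i u \<xi>)) \<in> pifields_on M ?W" for \<xi>
    unfolding connection_map_def
    by (rule connection_smooth[OF D(1) W coordvec_vector_field[OF atlas_slit[OF M]] \<eta>])
  have cz: "?c z \<in> ?W" "?c z \<in> pts (slit M)" "fst (?c z) \<in> cdom M i" if "z \<in> ?S" for z
    using cinv_image(1)[OF that] mem_slit_cdom_iff[OF M] by auto
  have tangent: "coordvec (slit M) i (?c z) \<xi> \<in> tspace (slit M) (?c z)" if "z \<in> ?S" for z \<xi>
    using coordvec_in_tspace[OF atlas_slit[OF M] cz(1)[OF that]] .
  have lin: "linear (A z)" if z: "z \<in> ?S" for z
  proof -
    have "A z (a *\<^sub>R \<xi> + b *\<^sub>R \<zeta>) = a *\<^sub>R A z \<xi> + b *\<^sub>R A z \<zeta>" for a b \<xi> \<zeta>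
      using connection_map_linear[OF D(1) cz(2)[OF z] tangent[OF z] tangent[OF z], of a \<xi> b \<zeta>]
        linear_coordvec[OF atlas_slit[OF M] cz(1)[OF z]]
      by (simp add: A_def linear_add linear_scale scaleR_fun_def[where 'b = 'e])
    from this[of 1 _ 1] this[of _ _ 0] show ?thesis by (intro linearI) auto
  qed
  have inj: "inj (A z)" if z: "z \<in> ?S" for z
    unfolding linear_injective_0[OF lin[OF z]]
  proof (intro allI impI)
    fix \<xi> assume "A z \<xi> = 0"
    let ?u = "?c z" and ?\<xi> = "coordvec (slit M) i (?c z) \<xi>"
    have 0: "fst \<xi> = 0" "connection_map D ?u ?\<xi> i = 0"
      using \<open>A z \<xi> = 0\<close> by (simp_all add: A_def zero_prod_def)
    have self: "?\<xi> i = \<xi>" using coordvec_self[OF atlas_slit[OF M] cz(1)[OF z]] .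
    have zero: "0 \<in> tspace M (fst ?u)" by (rule subspace_0[OF subspace_tspace[OF M]])
    have "connection_map D ?u ?\<xi> \<in> tspace M (fst ?u)"
      using K[of \<xi>] cz(1)[OF z] by (simp add: pifields_on_iff[OF M W])
    then have "connection_map D ?u ?\<xi> = 0"
      by (rule tspace_eqI[OF M _ zero cz(3)[OF z]]) (simp add: 0)
    moreover have "rho M ?u ?\<xi> = 0"
      by (rule tspace_eqI[OF M rho_in_tspace[OF M cz(2)[OF z]] zero cz(3)[OF z]])
        (simp add: rho_tangent[OF M cz(2)[OF z] tangent[OF z]] self 0)
    ultimately have "?\<xi> \<in> vspace M ?u \<inter> hspace M D ?u"
      using tangent[OF z] by (simp add: vspace_def hspace_def)
    then have "?\<xi> = 0" using regular_Int[OF D(2) cz(2)[OF z]] by auto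
    then show "\<xi> = 0" using self by simp
  qed
  have smoothA: "smooth_on ?S (\<lambda>z. A z \<xi>)" for \<xi>
  proof -
    have "\<forall>j. smooth_on (chart (slit M) j ` (?W \<inter> cdom (slit M) j))
        (\<lambda>z. connection_map D (cinv (slit M) j z) (coordvec (slit M) i (cinv (slit M) j z) \<xi>) j)"
      using K[of \<xi>] by (simp add: pifields_on_iff[OF M W])
    from spec[OF this, of i] show ?thesis
      unfolding A_def by (intro smooth_on_Pair smooth_on_const opn) simp
  qed
  have "A z (hfield M D X (?c z) i) = (X (?c z) i, 0)" if z: "z \<in> ?S" for z
  proof -
    let ?\<xi> = "hlift M D (?c z) (X (?c z))"
    have \<xi>: "?\<xi> \<in> tspace (slit M) (?c z)" "connection_map D (?c z) ?\<xi> = 0"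
      using lift(1)[OF cz(2)[OF z]] by (auto simp: hspace_def)
    have "coordvec (slit M) i (?c z) (?\<xi> i) = ?\<xi>"
      using tspace_eq_coordvec[OF atlas_slit[OF M] \<xi>(1) cz(1)[OF z]] by simp
    moreover have "fst (?\<xi> i) = X (?c z) i"
      using rho_tangent[OF M cz(2)[OF z] \<xi>(1)] lift(2)[OF cz(2)[OF z]] by metis
    ultimately show ?thesis by (simp add: A_def hfield_def \<xi>(2))
  qed
  moreover have "smooth_on ?S (\<lambda>z. (X (?c z) i, 0::'e))"
    using X by (intro smooth_on_Pair smooth_on_const opn) (simp add: pifields_iff[OF M])
  ultimately have sm: "smooth_on ?S (\<lambda>z. A z (hfield M D X (?c z) i))"
    using smooth_on_cong[OF opn, of "\<lambda>z. A z (hfield M D X (?c z) i)" "\<lambda>z. (X (?c z) i, 0)"] by simp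
  have "smooth_on ?S (\<lambda>z. hfield M D X (?c z) i)"
    by (rule smooth_on_linear_system_solution[where A = A, OF opn])
      (erule lin, erule inj, rule smoothA, rule sm)
  then show "smooth_on (chart (slit M) i ` (pts (slit M) \<inter> cdom (slit M) i)) (\<lambda>z. hfield M D X (?c z) i)"
    using atlas_cdom_subset[OF atlas_slit[OF M], of i] by (simp add: Int_absorb1)
qed

section \<open>Differentiation along the fibres and the mixed torsion\<close>

text \<open>
  The derivative at \<open>t = 0\<close> of \<open>Y\<close> along the curve \<open>u + t v\<close>. The fibre of the pullback bundle is the
  same vector space at all points of this curve, so it is defined without a connection; it is the
  flat covariant derivative along the fibres.
\<close>

definition fibre_deriv :: "('m, 'i, 'e) pifield \<Rightarrow> 'm \<times> ('i \<Rightarrow> 'e) \<Rightarrow> ('i \<Rightarrow> 'e) \<Rightarrow> ('i \<Rightarrow> 'e)"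
  where "fibre_deriv Y u v = (\<lambda>i. vector_derivative (\<lambda>t. Y (fst u, snd u + t *\<^sub>R v) i) (at 0))"

lemma fibre_line_in_slit:
  assumes u: "u \<in> cdom (slit M) i" and v: "v \<in> tspace M (fst u)" and t: "snd u i + t *\<^sub>R v i \<noteq> 0"
  shows "(fst u, snd u + t *\<^sub>R v) \<in> cdom (slit M) i"
proof -
  have "snd u + t *\<^sub>R v \<noteq> 0"
    using t by (metis plus_fun_apply scaleR_fun_def zero_fun_apply)
  moreover have "snd u + t *\<^sub>R v \<in> tspace M (fst u)"
    using u v subspace_tspace[OF M] by (auto simp: slit_cdom intro!: subspace_add subspace_scale)
  ultimately show ?thesis using u by (simp add: slit_cdom)
qed

lemma fibre_line_open:
  assumes u: "u \<in> cdom (slit M) i"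
  shows "open {t. snd u i + t *\<^sub>R v i \<noteq> 0}" "0 \<in> {t. snd u i + t *\<^sub>R v i \<noteq> 0}"
  using slit_component_nonzero[OF M u] by (auto intro!: open_Collect_neq continuous_intros)

lemma fibre_line_has_vector_derivative:
  assumes Y: "Y \<in> pifields M" and u: "u \<in> cdom (slit M) i" and v: "v \<in> tspace M (fst u)"
  shows "((\<lambda>t. Y (fst u, snd u + t *\<^sub>R v) i) has_vector_derivative
    frechet_derivative (\<lambda>z. Y (cinv (slit M) i z) i) (at (chart (slit M) i u)) (0, v i)) (at 0)"
proof -
  let ?G = "\<lambda>z. Y (cinv (slit M) i z) i" and ?z = "chart (slit M) i u"
  let ?d = "frechet_derivative ?G (at ?z)"
  have "smooth_on (chart (slit M) i ` cdom (slit M) i) ?G" using Y by (simp add: pifields_iff[OF M])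
  then have G: "(?G has_derivative ?d) (at (?z + 0 *\<^sub>R (0, v i)))"
    using smooth_on_has_derivative[of "chart (slit M) i ` cdom (slit M) i" ?G ?z] u
    by (simp flip: zero_prod_def)
  have line: "((\<lambda>t. ?z + t *\<^sub>R (0, v i)) has_derivative (\<lambda>t. t *\<^sub>R (0, v i))) (at 0)"
    by (auto intro!: derivative_eq_intros)
  have "((\<lambda>t. ?G (?z + t *\<^sub>R (0, v i))) has_derivative (\<lambda>t. ?d (t *\<^sub>R (0, v i)))) (at 0)"
    using has_derivative_compose[OF line G] .
  then have "((\<lambda>t. ?G (?z + t *\<^sub>R (0, v i))) has_vector_derivative ?d (0, v i)) (at 0)"
    unfolding has_vector_derivative_def by (simp only: linear_scale[OF has_derivative_linear[OF G]])
  then show ?thesis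
  proof (rule has_vector_derivative_transform_within_open[OF _ fibre_line_open[OF u, of v]])
    fix t assume "t \<in> {t. snd u i + t *\<^sub>R v i \<noteq> 0}"
    then have "(fst u, snd u + t *\<^sub>R v) \<in> cdom (slit M) i" using fibre_line_in_slit[OF u v] by blast
    moreover have "?z + t *\<^sub>R (0, v i) = chart (slit M) i (fst u, snd u + t *\<^sub>R v)"
      by (simp add: slit_chart scaleR_fun_def)
    ultimately show "?G (?z + t *\<^sub>R (0, v i)) = Y (fst u, snd u + t *\<^sub>R v) i"
      by (simp only: atlas_cinv_chart[OF atlas_slit[OF M]])
  qed
qed

lemma fibre_deriv_chart:
  assumes "Y \<in> pifields M" "u \<in> cdom (slit M) i" "v \<in> tspace M (fst u)"
  shows "fibre_deriv Y u v i =
    frechet_derivative (\<lambda>z. Y (cinv (slit M) i z) i) (at (chart (slit M) i u)) (0, v i)"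
  unfolding fibre_deriv_def by (rule vector_derivative_at[OF fibre_line_has_vector_derivative[OF assms]])

lemma fibre_deriv_cong:
  assumes u: "u \<in> pts (slit M)" and v: "v \<in> tspace M (fst u)" and Y: "Y \<in> pifields M"
    and eq: "\<And>w. w \<in> pts (slit M) \<Longrightarrow> Y w = Z w"
  shows "fibre_deriv Y u v = fibre_deriv Z u v"
proof
  fix j
  obtain i where i: "u \<in> cdom (slit M) i" using atlas_pts_chart[OF atlas_slit[OF M] u] by blast
  have line: "(fst u, snd u + t *\<^sub>R v) \<in> pts (slit M)" if "t \<in> {t. snd u i + t *\<^sub>R v i \<noteq> 0}" for t
    using fibre_line_in_slit[OF i v] that atlas_cdom_subset[OF atlas_slit[OF M]] by blast
  have "((\<lambda>t. Y (fst u, snd u + t *\<^sub>R v) j) has_vector_derivative d) (at 0) \<longleftrightarrow>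
        ((\<lambda>t. Z (fst u, snd u + t *\<^sub>R v) j) has_vector_derivative d) (at 0)" for d
    using has_vector_derivative_transform_within_open[OF _ fibre_line_open[OF i, of v],
        of "\<lambda>t. Y (fst u, snd u + t *\<^sub>R v) j" d "\<lambda>t. Z (fst u, snd u + t *\<^sub>R v) j"]
      has_vector_derivative_transform_within_open[OF _ fibre_line_open[OF i, of v],
        of "\<lambda>t. Z (fst u, snd u + t *\<^sub>R v) j" d "\<lambda>t. Y (fst u, snd u + t *\<^sub>R v) j"]
      eq[OF line] by auto
  then show "fibre_deriv Y u v j = fibre_deriv Z u v j"
    by (simp add: fibre_deriv_def vector_derivative_def)
qed

text \<open>
  Along the curve \<open>u + t v\<close> the base point is fixed, so the components in two charts are related by
  a constant Jacobian, which commutes with differentiation in \<open>t\<close>.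
\<close>

lemma fibre_deriv_in_tspace:
  assumes u: "u \<in> pts (slit M)" and v: "v \<in> tspace M (fst u)" and Y: "Y \<in> pifields M"
  shows "fibre_deriv Y u v \<in> tspace M (fst u)"
proof (rule tspaceI)
  have YT: "Y (fst u, snd u + t *\<^sub>R v) \<in> tspace M (fst u)"
    if "u \<in> cdom (slit M) i" "t \<in> {t. snd u i + t *\<^sub>R v i \<noteq> 0}" for i t
  proof -
    have "(fst u, snd u + t *\<^sub>R v) \<in> pts (slit M)"
      using fibre_line_in_slit[OF that(1) v] that(2) atlas_cdom_subset[OF atlas_slit[OF M]] by blast
    then show ?thesis using Y by (fastforce simp: pifields_iff[OF M])
  qed
  show "fibre_deriv Y u v j = 0" if "fst u \<notin> cdom M j" for j
  proof -
    obtain i where i: "u \<in> cdom (slit M) i" using atlas_pts_chart[OF atlas_slit[OF M] u] by blast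
    \<comment> \<open>in a chart that does not contain the base point the components of \<open>Y\<close> along the curve are \<open>0\<close> by convention\<close>
    have "((\<lambda>t. 0) has_vector_derivative 0) (at (0::real))" by (rule has_vector_derivative_const)
    then have "((\<lambda>t. Y (fst u, snd u + t *\<^sub>R v) j) has_vector_derivative 0) (at 0)"
      by (rule has_vector_derivative_transform_within_open[OF _ fibre_line_open[OF i, of v]])
        (simp add: tspace_zero[OF YT[OF i] that])
    then show ?thesis unfolding fibre_deriv_def by (rule vector_derivative_at)
  qed
  show "fibre_deriv Y u v j = jac M i j (fst u) (fibre_deriv Y u v i)"
    if ij: "fst u \<in> cdom M i" "fst u \<in> cdom M j" for i j
  proof -
    have i: "u \<in> cdom (slit M) i" using u ij by (simp add: mem_slit_cdom_iff[OF M])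
    have bl: "bounded_linear (jac M i j (fst u))"
      using linear_jac[OF M ij] by (simp add: linear_conv_bounded_linear)
    have "((\<lambda>t. Y (fst u, snd u + t *\<^sub>R v) i) has_vector_derivative fibre_deriv Y u v i) (at 0)"
      using fibre_line_has_vector_derivative[OF Y i v] by (simp only: fibre_deriv_chart[OF Y i v])
    from bounded_linear.has_vector_derivative[OF bl this]
    have "((\<lambda>t. Y (fst u, snd u + t *\<^sub>R v) j) has_vector_derivative
        jac M i j (fst u) (fibre_deriv Y u v i)) (at 0)"
      by (rule has_vector_derivative_transform_within_open[OF _ fibre_line_open[OF i, of v]])
        (rule tspace_jac[OF YT[OF i] ij, symmetric])
    then show ?thesis unfolding fibre_deriv_def[of Y u v] by (rule vector_derivative_at)
  qed
qed

lemma fibre_deriv_in_pifields: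
  assumes Y: "Y \<in> pifields M" and X: "X \<in> pifields M"
  shows "(\<lambda>u. fibre_deriv Y u (X u)) \<in> pifields M"
  unfolding pifields_iff[OF M]
proof (intro conjI ballI allI)
  have XT: "X u \<in> tspace M (fst u)" if "u \<in> pts (slit M)" for u
    using X that by (simp add: pifields_iff[OF M])
  then show "fibre_deriv Y u (X u) \<in> tspace M (fst u)" if "u \<in> pts (slit M)" for u
    using that fibre_deriv_in_tspace Y by blast
  fix i
  let ?S = "chart (slit M) i ` cdom (slit M) i" and ?c = "cinv (slit M) i"
  have opn: "open ?S" using atlas_open_image[OF atlas_slit[OF M]] .
  have sm: "smooth_on ?S (\<lambda>z. Y (?c z) i)" "smooth_on ?S (\<lambda>z. X (?c z) i)"
    using X Y by (auto simp: pifields_iff[OF M])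
  have "smooth_on ?S (\<lambda>z. frechet_derivative (\<lambda>z. Y (?c z) i) (at z) (0, X (?c z) i))"
    by (rule smooth_on_derivative_along[where g = "\<lambda>z. z" and f = "\<lambda>z. Y (?c z) i",
          OF opn opn _ smooth_on_bounded_linear[OF opn bounded_linear_ident] sm(1)])
      (auto intro!: smooth_on_Pair smooth_on_const opn sm)
  moreover have "fibre_deriv Y (?c z) (X (?c z)) i =
      frechet_derivative (\<lambda>z. Y (?c z) i) (at z) (0, X (?c z) i)" if z: "z \<in> ?S" for z
  proof -
    have "?c z \<in> pts (slit M)" using cinv_image(1)[OF z] mem_slit_cdom_iff[OF M] by blast
    from fibre_deriv_chart[OF Y cinv_image(1)[OF z] XT[OF this]]
    show ?thesis by (simp only: cinv_image(2)[OF z])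
  qed
  ultimately show "smooth_on ?S (\<lambda>z. fibre_deriv Y (?c z) (X (?c z)) i)"
    using smooth_on_cong[OF opn, of "\<lambda>z. fibre_deriv Y (?c z) (X (?c z)) i"
      "\<lambda>z. frechet_derivative (\<lambda>z. Y (?c z) i) (at z) (0, X (?c z) i)"] by simp
qed

text \<open>
  In coordinates \<open>(x, y)\<close>, the vertical lift of \<open>X\<close> is \<open>(0, X)\<close> and \<open>H\<close> is \<open>(Y, \<dots>)\<close>. The first component of
  their bracket is the derivative of \<open>Y\<close> along \<open>(0, X)\<close> minus the derivative of \<open>0\<close> along \<open>H\<close>. In
  particular it depends on \<open>H\<close> only through its projection \<open>Y\<close>.
\<close>

lemma rho_lie_bracket_vertical:
  assumes X: "X \<in> pifields M" and Y: "Y \<in> pifields M"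
    and H: "H \<in> vector_fields (slit M) (pts (slit M))"
    and rho_H: "\<And>w. w \<in> pts (slit M) \<Longrightarrow> rho M w (H w) = Y w"
    and u: "u \<in> pts (slit M)"
  shows "rho M u (lie_bracket (slit M) (vfield M X) H u) = fibre_deriv Y u (X u)"
proof -
  \<comment> \<open>in this chart both derivatives in the bracket and \<open>\<rho>\<close> are evaluated, so no change of
    coordinates has to be differentiated\<close>
  define i where "i = chart_at (slit M) u"
  have i: "u \<in> cdom (slit M) i" unfolding i_def using chart_at[OF atlas_slit[OF M] u] .
  have p: "fst u \<in> cdom M i" using i mem_slit_cdom_iff[OF M] by blast
  have XT: "X u \<in> tspace M (fst u)" using X u by (simp add: pifields_iff[OF M])
  let ?S = "chart (slit M) i ` cdom (slit M) i" and ?c = "cinv (slit M) i"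
  let ?z = "chart (slit M) i u"
  have opn: "open ?S" and zS: "?z \<in> ?S" using atlas_open_image[OF atlas_slit[OF M]] i by auto
  have fst_deriv: "fst (dirderiv (slit M) (\<lambda>q. V q i) u \<xi>) =
      frechet_derivative f (at ?z) (\<xi> i)"
    if V: "V \<in> vector_fields (slit M) (pts (slit M))" and f: "\<And>z. z \<in> ?S \<Longrightarrow> fst (V (?c z) i) = f z"
    for V f \<xi>
  proof -
    have "smooth_on ?S (\<lambda>z. V (?c z) i)"
      using V Int_absorb1[OF atlas_cdom_subset[OF atlas_slit[OF M], of i]]
      by (simp add: vector_fields_iff[OF atlas_slit[OF M] slit_mopen_pts]) metis
    then have "((\<lambda>z. fst (V (?c z) i)) has_derivative
        (\<lambda>\<xi>. fst (frechet_derivative (\<lambda>z. V (?c z) i) (at ?z) \<xi>))) (at ?z)"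
      by (intro has_derivative_fst smooth_on_has_derivative[OF _ zS])
    then have "(f has_derivative
        (\<lambda>\<xi>. fst (frechet_derivative (\<lambda>z. V (?c z) i) (at ?z) \<xi>))) (at ?z)"
      by (rule has_derivative_transform_within_open[OF _ opn zS]) (rule f)
    from frechet_derivative_at[OF this, symmetric] show ?thesis
      by (simp add: dirderiv_chart_at comp_def flip: i_def)
  qed
  have "fst (dirderiv (slit M) (\<lambda>q. H q i) u (vfield M X u))
      = frechet_derivative (\<lambda>z. Y (?c z) i) (at ?z) (vfield M X u i)"
  proof (rule fst_deriv[OF H])
    fix z assume z: "z \<in> ?S"
    have c: "?c z \<in> pts (slit M)" using cinv_image(1)[OF z] mem_slit_cdom_iff[OF M] by blast
    then have "H (?c z) \<in> tspace (slit M) (?c z)"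
      using H by (simp add: vector_fields_iff[OF atlas_slit[OF M] slit_mopen_pts])
    from rho_tangent[OF M c this] show "fst (H (?c z) i) = Y (?c z) i"
      using rho_H[OF c] by metis
  qed
  also have "\<dots> = fibre_deriv Y u (X u) i"
    using i by (simp add: fibre_deriv_chart[OF Y i XT] vfield_def vlift_eq[OF M])
  finally have 1: "fst (dirderiv (slit M) (\<lambda>q. H q i) u (vfield M X u)) = fibre_deriv Y u (X u) i" .
  have 2: "fst (dirderiv (slit M) (\<lambda>q. vfield M X q i) u (H u)) = frechet_derivative (\<lambda>z. 0) (at ?z) (H u i)"
    by (rule fst_deriv[OF vfield_vector_field[OF M X]])
      (use cinv_image(1) in \<open>simp add: vfield_def vlift_eq[OF M]\<close>)
  have "fst (lie_bracket (slit M) (vfield M X) H u i) = fibre_deriv Y u (X u) i"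
    using i 1 2 by (simp add: lie_bracket_def)
  then have "rho M u (lie_bracket (slit M) (vfield M X) H u) = coordvec M i (fst u) (fibre_deriv Y u (X u) i)"
    using rho_chart_at[OF M u] by (simp flip: i_def)
  then show ?thesis
    using tspace_eq_coordvec[OF M fibre_deriv_in_tspace[OF u XT Y] p] by simp
qed

text \<open>
  The mixed torsion measures how far the vertical covariant derivative is from the flat derivative
  along the fibres. The connection enters only through its vertical part: the horizontal lift drops
  out, because the bracket depends on its projection only and \<open>\<rho>\<close> kills vertical vectors.
\<close>

lemma vh_torsion_eq:
  assumes D: "is_connection M D" "regular M D" and X: "X \<in> pifields M" and Y: "Y \<in> pifields M"
    and u: "u \<in> pts (slit M)"
  shows "vh_torsion M D X Y u = D u (vlift M u (X u)) Y - fibre_deriv Y u (X u)"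
proof -
  let ?H = "hfield M D Y"
  have H: "?H \<in> vector_fields (slit M) (pts (slit M))" using hfield_vector_field[OF D Y] .
  have HT: "?H u \<in> tspace (slit M) u"
    using H u by (simp add: vector_fields_iff[OF atlas_slit[OF M] slit_mopen_pts])
  have VT: "vlift M u (X u) \<in> tspace (slit M) u"
    using X u by (intro vlift_in_tspace[OF M]) (simp add: pifields_iff[OF M])
  have rho_H: "rho M w (?H w) = Y w" if "w \<in> pts (slit M)" for w
    using rho_hlift[OF D that] Y that by (simp add: hfield_def pifields_iff[OF M])
  have "D u (vlift M u (X u)) (rhofield M ?H) = D u (vlift M u (X u)) Y"
    by (rule connection_cong[OF D(1) u VT Y, symmetric]) (simp add: rhofield_def rho_H)
  moreover have "D u (?H u) (rhofield M (vfield M X)) = 0"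
    by (rule connection_zero[OF D(1) u HT]) (simp add: rhofield_def vfield_def rho_vlift[OF M])
  ultimately show ?thesis
    using rho_lie_bracket_vertical[OF X Y H rho_H u]
    by (simp add: vh_torsion_def torsion_def cov_def rhofield_def[of M "lie_bracket _ _ _"] vfield_def[of M X])
qed

lemma vh_torsion_in_pifields:
  assumes D: "is_connection M D" "regular M D" and X: "X \<in> pifields M" and Y: "Y \<in> pifields M"
  shows "vh_torsion M D X Y \<in> pifields M"
proof -
  have "(\<lambda>u. 1 *\<^sub>R cov D (vfield M X) Y u + (- 1) *\<^sub>R fibre_deriv Y u (X u)) \<in> pifields M"
    by (rule pifields_linear_combination[OF M cov_in_pifields[OF D(1) vfield_vector_field[OF M X] Y]
        fibre_deriv_in_pifields[OF Y X]])
  then show ?thesis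
    by (subst pifields_cong[OF M, of _ "\<lambda>u. 1 *\<^sub>R cov D (vfield M X) Y u + (- 1) *\<^sub>R fibre_deriv Y u (X u)"])
      (simp_all add: vh_torsion_eq[OF D X Y] cov_def vfield_def)
qed

text \<open>
  Fields may take any values outside the slit bundle; those values do not influence the torsion.
\<close>

lemma vh_torsion_cong:
  assumes D: "is_connection M D" "regular M D"
    and P: "P \<in> pifields M" "\<And>u. u \<in> pts (slit M) \<Longrightarrow> P u = P' u"
    and Q: "Q \<in> pifields M" "\<And>u. u \<in> pts (slit M) \<Longrightarrow> Q u = Q' u"
    and u: "u \<in> pts (slit M)"
  shows "vh_torsion M D P Q u = vh_torsion M D P' Q' u"
proof -
  have PQ': "P' \<in> pifields M" "Q' \<in> pifields M"
    using pifields_cong[OF M P(2)] pifields_cong[OF M Q(2)] P(1) Q(1) by simp_all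
  have Pu: "P u \<in> tspace M (fst u)" using P(1) u by (simp add: pifields_iff[OF M])
  have "D u (vlift M u (P u)) Q = D u (vlift M u (P u)) Q'"
    by (rule connection_cong[OF D(1) u vlift_in_tspace[OF M Pu] Q])
  moreover have "fibre_deriv Q u (P u) = fibre_deriv Q' u (P u)"
    by (rule fibre_deriv_cong[OF u Pu Q])
  ultimately show ?thesis
    by (simp add: vh_torsion_eq[OF D P(1) Q(1) u] vh_torsion_eq[OF D PQ' u] P(2)[OF u, symmetric])
qed

end

section \<open>Two connections with the same horizontal derivative\<close>

context
  fixes M :: "('m, 'i, 'e::euclidean_space) mfd" and D D' :: "('m, 'i, 'e) connection"
  assumes M: "atlas M"
    and D: "is_connection M D" "regular M D" and D': "is_connection M D'" "regular M D'"
begin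

text \<open>
  The flat derivatives along the fibres in the two mixed torsions cancel.
\<close>

lemma vh_torsion_difference:
  assumes "X \<in> pifields M" "Y \<in> pifields M" "u \<in> pts (slit M)"
  shows "vh_torsion M D' X Y u = vh_torsion M D X Y u + vert_difference M D D' X Y u"
  by (simp add: vh_torsion_eq[OF M D assms] vh_torsion_eq[OF M D' assms]
      vert_difference_def cov_def vfield_def)

lemma vert_difference_in_pifields:
  assumes "X \<in> pifields M" "Y \<in> pifields M"
  shows "vert_difference M D D' X Y \<in> pifields M"
proof -
  have V: "vfield M X \<in> vector_fields (slit M) (pts (slit M))"
    by (rule vfield_vector_field[OF M assms(1)])
  have "(\<lambda>u. 1 *\<^sub>R cov D' (vfield M X) Y u + (- 1) *\<^sub>R cov D (vfield M X) Y u) \<in> pifields M"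
    by (rule pifields_linear_combination[OF M cov_in_pifields[OF M D'(1) V assms(2)]
          cov_in_pifields[OF M D(1) V assms(2)]])
  then show ?thesis by (simp add: vert_difference_def)
qed

context
  assumes B: "vanishes M (hor_difference M D D')"
begin

text \<open>
  Applying \<open>B = 0\<close> to the fundamental field shows that the connection map of \<open>D'\<close> vanishes on the
  horizontal vectors of \<open>D\<close>. The two connections thus have the same horizontal lift.
\<close>

lemma hfield_eq:
  assumes X: "X \<in> pifields M" and u: "u \<in> pts (slit M)"
  shows "hfield M D' X u = hfield M D X u"
proof -
  have Xu: "X u \<in> tspace M (fst u)" using X u by (simp add: pifields_iff[OF M])
  have h: "hlift M D u (X u) \<in> hspace M D u" by (rule hlift_in_hspace[OF M D u Xu])
  have "hor_difference M D D' X fundamental u = 0"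
    using B X u fundamental_in_pifields[OF M] by (simp add: vanishes_def)
  then have "hlift M D u (X u) \<in> hspace M D' u"
    using h by (simp add: hspace_def hor_difference_def cov_def hfield_def connection_map_def)
  from hlift_eqI[OF M D' u this rho_hlift[OF M D u Xu]] show ?thesis
    by (simp add: hfield_def)
qed

lemma cov_hfield_eq:
  assumes X: "X \<in> pifields M" and Y: "Y \<in> pifields M" and u: "u \<in> pts (slit M)"
  shows "cov D' (hfield M D' X) Y u = cov D (hfield M D X) Y u"
proof -
  have "hor_difference M D D' X Y u = 0"
    using B X Y u by (simp add: vanishes_def)
  then show ?thesis by (simp add: hor_difference_def cov_def hfield_eq[OF X u])
qed

end

end

text \<open>
  Since \<open>T' = T + A\<close> and both connections have the same covariant derivative in horizontal
  directions, \<open>\<nabla>'T' = \<nabla>T + \<nabla>A\<close> there. Each of the three terms of the covariant derivative of a tensor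
  splits accordingly; smoothness of \<open>T\<close>, \<open>A\<close> and of the horizontal derivatives of fields is what makes
  the connection axioms applicable to them.
\<close>

lemma cov_vh_torsion_difference:
  fixes M :: "('m, 'i, 'e::euclidean_space) mfd"
  assumes M: "atlas M"
    and D: "is_connection M D" "regular M D" and D': "is_connection M D'" "regular M D'"
    and B: "vanishes M (hor_difference M D D')"
    and X: "X \<in> pifields M" and Y: "Y \<in> pifields M" and Z: "Z \<in> pifields M"
    and u: "u \<in> pts (slit M)"
  shows "cov_tensor D' (hfield M D' X) (vh_torsion M D') Y Z u =
    cov_tensor D (hfield M D X) (vh_torsion M D) Y Z u +
    cov_tensor D (hfield M D X) (vert_difference M D D') Y Z u"
proof -
  let ?T = "vh_torsion M D" and ?T' = "vh_torsion M D'" and ?A = "vert_difference M D D'"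
  let ?N = "cov D (hfield M D X)" and ?N' = "cov D' (hfield M D' X)"
  have split: "?T' P Q u = ?T P Q u + ?A P Q u"
    if "P \<in> pifields M" "Q \<in> pifields M" "u \<in> pts (slit M)" for P Q u
    using vh_torsion_difference[OF M D D' that] .
  have N: "?N P \<in> pifields M" and N': "?N' P \<in> pifields M" if "P \<in> pifields M" for P
    using cov_in_pifields[OF M D(1) hfield_vector_field[OF M D X] that]
      cov_in_pifields[OF M D'(1) hfield_vector_field[OF M D' X] that] .
  have NN': "?N' P w = ?N P w" if "P \<in> pifields M" "w \<in> pts (slit M)" for P w
    using cov_hfield_eq[OF M D D' B X that] .
  have T: "?T Y Z \<in> pifields M" and T': "?T' Y Z \<in> pifields M" and A: "?A Y Z \<in> pifields M"
    using vh_torsion_in_pifields[OF M D Y Z] vh_torsion_in_pifields[OF M D' Y Z]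
      vert_difference_in_pifields[OF M D D' Y Z] .
  have H: "hfield M D X u \<in> tspace (slit M) u"
    using hlift_in_hspace[OF M D u, of "X u"] X u by (simp add: hfield_def hspace_def pifields_iff[OF M])
  have "?N' (?T' Y Z) u = ?N (?T' Y Z) u"
    by (rule NN'[OF T' u])
  also have "\<dots> = ?N (\<lambda>w. ?T Y Z w + ?A Y Z w) u"
    unfolding cov_def by (rule connection_cong[OF M D(1) u H T']) (rule split[OF Y Z])
  also have "\<dots> = ?N (?T Y Z) u + ?N (?A Y Z) u"
    unfolding cov_def by (rule connection_add[OF M D(1) u H T A])
  finally have 1: "?N' (?T' Y Z) u = ?N (?T Y Z) u + ?N (?A Y Z) u" .
  have "?T' (?N' Y) Z u = ?T' (?N Y) Z u"
    by (rule vh_torsion_cong[OF M D' N'[OF Y] _ Z _ u]) (simp_all add: NN' Y)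
  then have 2: "?T' (?N' Y) Z u = ?T (?N Y) Z u + ?A (?N Y) Z u"
    using split[OF N[OF Y] Z u] by simp
  have "?T' Y (?N' Z) u = ?T' Y (?N Z) u"
    by (rule vh_torsion_cong[OF M D' Y _ N'[OF Z] _ u]) (simp_all add: NN' Z)
  then have 3: "?T' Y (?N' Z) u = ?T Y (?N Z) u + ?A Y (?N Z) u"
    using split[OF Y N[OF Z] u] by simp
  show ?thesis unfolding cov_tensor_def 1 2 3 by simp
qed

theorem theorem5p1:
  fixes M :: "('m, 'i, 'e::euclidean_space) mfd"
    and L L' :: "'m \<times> ('i \<Rightarrow> 'e) \<Rightarrow> real"
    and D D' :: "('m, 'i, 'e) connection"
  assumes "manifold M"
    and "finsler M L" and "finsler M L'"
    and "cartan_connection M L D" and "cartan_connection M L' D'"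
    and "vanishes M (hor_difference M D D')"
  shows "(berwald M D \<longrightarrow>
            (berwald M D' \<longleftrightarrow> h_parallel M D (vert_difference M D D'))) \<and>
         (berwald M D' \<longrightarrow>
            (berwald M D \<longleftrightarrow> h_parallel M D (vert_difference M D D')))"
proof -
  have M: "atlas M" using assms(1) by (rule manifold_imp_atlas)
  have D: "is_connection M D" "regular M D" and D': "is_connection M D'" "regular M D'"
    using assms(4,5) by (simp_all add: cartan_connection_def)
  have "cov_tensor D' (hfield M D' X) (vh_torsion M D') Y Z u =
      cov_tensor D (hfield M D X) (vh_torsion M D) Y Z u +
      cov_tensor D (hfield M D X) (vert_difference M D D') Y Z u"
    if "X \<in> pifields M" "Y \<in> pifields M" "Z \<in> pifields M" "u \<in> pts (slit M)" for X Y Z u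
    using cov_vh_torsion_difference[OF M D D' assms(6) that] .
  then show ?thesis
    unfolding berwald_def h_parallel_def vanishes_def by auto
qed

end
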